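(* Let $\Gamma$ be a finite connected simple graph and let $G(\Gamma)$ be the group defined below. Let $0\le \lambda<\frac12$ and let $N\ge \frac{2|V(\Gamma)|+1}{1-2\lambda}$. Let $h\in G(\Gamma)$ and suppose there are two $(\lambda,N)$-quasi-root decompositions $$h=a_1g_1^{n_1}b_1=a_2g_2^{n_2}b_2$$ such that $g_1$ and $g_2$ are strongly non-split and primitive. Then $g_1$ and $g_2$ are conjugate; more precisely $a_1g_1a_1^{-1}=a_2g_2a_2^{-1}$ and $b_1^{-1}g_1b_1=b_2^{-1}g_2b_2$.
   Context: For a finite simple graph $\Gamma$, $G(\Gamma)=\langle v\in V(\Gamma)\mid [v_i,v_j]=1 \text{ if } \{v_i,v_j\}\notin E(\Gamma)\rangle$ (i.e. generators commute exactly when NOT adjacent; $G(\Gamma)$ is the right-angled Artin group on the complement graph). $|g|$ denotes the word length of $g$ with respect to the generators $V(\Gamma)$; a word is reduced if it is a shortest word representing its element. The support $\mathrm{supp}(g)$ is the set of generators $v$ such that $v$ or $v^{-1}$ appears in a reduced word representing $g$ (well defined). Two elements $g_1,g_2$ disjointly commute if $\mathrm{supp}(g_1)\cap\mathrm{supp}(g_2)=\emptyset$ and every $v_1\in\mathrm{supp}(g_1)$ commutes with every $v_2\in\mathrm{supp}(g_2)$, i.e. $\{v_1,v_2\}\notin E(\Gamma)$. An element $g$ is non-split if $\mathrm{supp}(g)$ spans a connected subgraph of $\Gamma$, and strongly non-split if it is non-split and no generator $v\in V(\Gamma)$ disjointly commutes with $g$. A nontrivial element $g$ is primitive if $g\neq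 u^n$ for all $u\in G(\Gamma)$ and $n\ge 2$. A decomposition $g=g_1\cdots g_k$ is geodesic if $|g|=|g_1|+\cdots+|g_k|$. For $0\le\lambda<\frac12$ and $N\ge 2$, a $(\lambda,N)$-quasi-root decomposition of $h$ is a geodesic decomposition $h=a\cdot g\cdot g\cdots g\cdot b=ag^nb$ (with $n$ factors $g$, i.e. $|h|=|a|+n|g|+|b|$) for some $n\ge N$ and $a,b\in G(\Gamma)$ with $|a|,|b|\le\lambda|h|$; then $g$ is called a $(\lambda,N)$-quasi-root of $h$. *)

theory Defs
  imports Complex_Main
begin

(* Elements of G(Gamma) are represented by words: lists of letters (v, b),
   where (v, True) stands for v and (v, False) for v^-1.
   The graph Gamma has vertex set V and symmetric irreflexive edge relation E. *)

type_synonym 'a word = "('a \<times> bool) list"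

definition simple_graph :: "'a set \<Rightarrow> ('a \<Rightarrow> 'a \<Rightarrow> bool) \<Rightarrow> bool" where
  "simple_graph V E \<longleftrightarrow> finite V \<and> (\<forall>x y. E x y \<longrightarrow> x \<in> V \<and> y \<in> V)
     \<and> (\<forall>x y. E x y \<longrightarrow> E y x) \<and> (\<forall>x. \<not> E x x)"

definition connected_on :: "('a \<Rightarrow> 'a \<Rightarrow> bool) \<Rightarrow> 'a set \<Rightarrow> bool" where
  "connected_on E S \<longleftrightarrow> (\<forall>x\<in>S. \<forall>y\<in>S. (\<lambda>a b. E a b \<and> a \<in> S \<and> b \<in> S)\<^sup>*\<^sup>* x y)"

definition is_word :: "'a set \<Rightarrow> 'a word \<Rightarrow> bool" where
  "is_word V w \<longleftrightarrow> (\<forall>l\<in>set w. fst l \<in> V)"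

definition inv_word :: "'a word \<Rightarrow> 'a word" where
  "inv_word w = rev (map (\<lambda>(v, b). (v, \<not> b)) w)"

definition pow_word :: "'a word \<Rightarrow> nat \<Rightarrow> 'a word" where
  "pow_word w n = concat (replicate n w)"

inductive raag_step :: "('a \<Rightarrow> 'a \<Rightarrow> bool) \<Rightarrow> 'a word \<Rightarrow> 'a word \<Rightarrow> bool" for E where
  cancel: "raag_step E (xs @ [(v, b), (v, \<not> b)] @ ys) (xs @ ys)"
| swap: "u \<noteq> v \<Longrightarrow> \<not> E u v \<Longrightarrow>
     raag_step E (xs @ [(u, b), (v, c)] @ ys) (xs @ [(v, c), (u, b)] @ ys)"

definition raag_eq :: "('a \<Rightarrow> 'a \<Rightarrow> bool) \<Rightarrow> 'a word \<Rightarrow> 'a word \<Rightarrow> bool" where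
  "raag_eq E = (\<lambda>x y. raag_step E x y \<or> raag_step E y x)\<^sup>*\<^sup>*"

definition wlen :: "'a set \<Rightarrow> ('a \<Rightarrow> 'a \<Rightarrow> bool) \<Rightarrow> 'a word \<Rightarrow> nat" where
  "wlen V E w = (LEAST n. \<exists>w'. is_word V w' \<and> raag_eq E w w' \<and> length w' = n)"

definition reduced :: "'a set \<Rightarrow> ('a \<Rightarrow> 'a \<Rightarrow> bool) \<Rightarrow> 'a word \<Rightarrow> bool" where
  "reduced V E w \<longleftrightarrow> is_word V w \<and> length w = wlen V E w"

definition supp :: "'a set \<Rightarrow> ('a \<Rightarrow> 'a \<Rightarrow> bool) \<Rightarrow> 'a word \<Rightarrow> 'a set" where
  "supp V E g = {v. \<exists>w. raag_eq E g w \<and> reduced V E w \<and> v \<in> fst ` set w}"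

definition disj_commute :: "'a set \<Rightarrow> ('a \<Rightarrow> 'a \<Rightarrow> bool) \<Rightarrow> 'a word \<Rightarrow> 'a word \<Rightarrow> bool" where
  "disj_commute V E g1 g2 \<longleftrightarrow> supp V E g1 \<inter> supp V E g2 = {}
     \<and> (\<forall>v1\<in>supp V E g1. \<forall>v2\<in>supp V E g2. \<not> E v1 v2)"

definition non_split :: "'a set \<Rightarrow> ('a \<Rightarrow> 'a \<Rightarrow> bool) \<Rightarrow> 'a word \<Rightarrow> bool" where
  "non_split V E g \<longleftrightarrow> connected_on E (supp V E g)"

definition strongly_non_split :: "'a set \<Rightarrow> ('a \<Rightarrow> 'a \<Rightarrow> bool) \<Rightarrow> 'a word \<Rightarrow> bool" where
  "strongly_non_split V E g \<longleftrightarrow> non_split V E g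
     \<and> (\<forall>v\<in>V. \<not> disj_commute V E [(v, True)] g)"

definition primitive :: "'a set \<Rightarrow> ('a \<Rightarrow> 'a \<Rightarrow> bool) \<Rightarrow> 'a word \<Rightarrow> bool" where
  "primitive V E g \<longleftrightarrow> \<not> raag_eq E g []
     \<and> (\<forall>u n. is_word V u \<and> n \<ge> 2 \<longrightarrow> \<not> raag_eq E g (pow_word u n))"

definition quasi_root_decomp ::
  "'a set \<Rightarrow> ('a \<Rightarrow> 'a \<Rightarrow> bool) \<Rightarrow> real \<Rightarrow> nat \<Rightarrow> 'a word \<Rightarrow> 'a word \<Rightarrow> 'a word \<Rightarrow> nat \<Rightarrow> 'a word \<Rightarrow> bool" where
  "quasi_root_decomp V E lam N h a g n b \<longleftrightarrow>
     0 \<le> lam \<and> lam < 1/2 \<and> N \<ge> 2 \<and> n \<ge> N \<and>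
     is_word V a \<and> is_word V g \<and> is_word V b \<and>
     raag_eq E h (a @ pow_word g n @ b) \<and>
     wlen V E h = wlen V E a + n * wlen V E g + wlen V E b \<and>
     real (wlen V E a) \<le> lam * real (wlen V E h) \<and>
     real (wlen V E b) \<le> lam * real (wlen V E h)"

end

theory Submission
  imports Defs "HOL-Library.Sublist" "HOL-Library.Multiset"
begin

text \<open>
  Reduced words of one element differ only by commutations, so the two decompositions of \<open>h\<close> are
  equal traces, where a trace is determined by its projections to pairs of dependent vertices and a
  prefix of a given trace by its number of occurrences of each vertex. Write \<open>d = card V - 1\<close>. As
  the support of \<open>g\<^sub>1\<close> is connected and dominating, every prefix of \<open>h\<close> either lies in
  \<open>a\<^sub>1 g\<^sub>1 ^ (i + d)\<close> or contains \<open>a\<^sub>1 g\<^sub>1 ^ i\<close>; the same holds for \<open>g\<^sub>2\<close>. The length hypothesis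
  then yields some \<open>j\<close> such that \<open>a\<^sub>2 g\<^sub>2 ^ j = a\<^sub>1 c\<close> lies deep inside both powers. There
  \<open>g = c\<inverse> g\<^sub>1 c\<close> is a positive trace, and both \<open>a\<^sub>1 c g g\<^sub>2\<close> and \<open>a\<^sub>1 c g\<^sub>2 g\<close> are prefixes of \<open>h\<close>
  with the same numbers of occurrences, so \<open>g\<close> and \<open>g\<^sub>2\<close> commute. Commuting traces of connected
  dominating support are powers of a common trace, and primitivity gives \<open>g = g\<^sub>2\<close>.
\<close>

section \<open>Words\<close>

abbreviation verts :: "('a \<times> 'b) list \<Rightarrow> 'a set" where
  "verts w \<equiv> fst ` set w"

abbreviation occ :: "('a \<times> 'b) list \<Rightarrow> 'a \<Rightarrow> nat" where
  "occ w \<equiv> count_list (map fst w)"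

abbreviation proj :: "'a \<Rightarrow> 'a \<Rightarrow> ('a \<times> 'b) list \<Rightarrow> ('a \<times> 'b) list" where
  "proj u v \<equiv> filter (\<lambda>l. fst l = u \<or> fst l = v)"

definition inv_letter :: "'a \<times> bool \<Rightarrow> 'a \<times> bool" where
  "inv_letter l = (fst l, \<not> snd l)"

lemma occ_pos_iff: "0 < occ w v \<longleftrightarrow> v \<in> verts w"
  using count_list_0_iff[of "map fst w" v] by auto

lemma length_proj: "length (proj u v w) = (if u = v then occ w v else occ w u + occ w v)"
  by (induction w) auto

lemma occ_proj: "occ (proj u v w) u = occ w u" "occ (proj u v w) v = occ w v"
  by (induction w) auto

lemma inv_letter_simps [simp]:
  "inv_letter (inv_letter l) = l" "fst (inv_letter l) = fst l"
  by (simp_all add: inv_letter_def)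

lemma is_word_iff_verts [simp]: "is_word V w \<longleftrightarrow> verts w \<subseteq> V"
  by (auto simp: is_word_def)

lemma inv_word_simps [simp]:
  "inv_word [] = []" "inv_word (l # w) = inv_word w @ [inv_letter l]"
  by (auto simp: inv_word_def inv_letter_def split: prod.splits)

lemma verts_inv_word [simp]: "verts (inv_word w) = verts w"
  by (induction w) auto

lemma pow_word_simps [simp]:
  "pow_word w 0 = []" "pow_word w (Suc n) = w @ pow_word w n"
  by (simp_all add: pow_word_def)

lemma pow_word_add: "pow_word w (m + n) = pow_word w m @ pow_word w n"
  by (simp add: pow_word_def replicate_add)

lemma pow_word_Suc_right: "pow_word w (Suc n) = pow_word w n @ w"
  using pow_word_add[of w n 1] by simp

lemma length_pow_word [simp]: "length (pow_word w n) = n * length w"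
  by (induction n) auto

lemma occ_pow_word [simp]: "occ (pow_word w n) v = n * occ w v"
  by (induction n) auto

lemma set_pow_word: "set (pow_word w n) = (if n = 0 then {} else set w)"
  by (simp add: pow_word_def)

section \<open>The group\<close>

locale raag =
  fixes E :: "'a \<Rightarrow> 'a \<Rightarrow> bool"
begin

abbreviation group_eq (infix "\<approx>" 50) where
  "x \<approx> y \<equiv> raag_eq E x y"

lemma raag_eq_equivclp: "raag_eq E = equivclp (raag_step E)"
  by (simp add: raag_eq_def equivclp_def symclp_def[abs_def])

lemma raag_eq_refl [simp]: "x \<approx> x"
  by (simp add: raag_eq_def)

lemma raag_eq_sym: "x \<approx> y \<Longrightarrow> y \<approx> x"
  unfolding raag_eq_equivclp by (rule equivclp_sym)

lemma raag_eq_trans [trans]: "x \<approx> y \<Longrightarrow> y \<approx> z \<Longrightarrow> x \<approx> z"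
  unfolding raag_eq_equivclp by (rule equivclp_trans)

lemma raag_step_imp_raag_eq: "raag_step E x y \<Longrightarrow> x \<approx> y"
  unfolding raag_eq_equivclp by (rule r_into_equivclp)

lemma raag_eq_preserves:
  assumes "x \<approx> y" and "equivp R" and "\<And>x y. raag_step E x y \<Longrightarrow> R (f x) (f y)"
  shows "R (f x) (f y)"
  using assms(1) unfolding raag_eq_equivclp
proof (induction rule: equivclp_induct)
  case base
  show ?case using assms(2) by (rule equivp_reflp)
next
  case (step y z)
  then show ?case using assms(2,3) by (meson equivp_symp equivp_transp)
qed

lemma raag_step_context: "raag_step E x y \<Longrightarrow> raag_step E (a @ x @ b) (a @ y @ b)"
proof (induction rule: raag_step.induct)
  case (cancel xs v c ys)
  show ?case using raag_step.cancel[of E "a @ xs" v c "ys @ b"] by simp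
next
  case (swap u v xs c d ys)
  then show ?case using raag_step.swap[of u v E "a @ xs" c d "ys @ b"] by simp
qed

lemma equivp_raag_eq: "equivp (raag_eq E)"
  by (simp add: raag_eq_equivclp)

lemma raag_eq_append:
  assumes "x \<approx> x'" and "y \<approx> y'"
  shows "x @ y \<approx> x' @ y'"
proof -
  have "a @ u @ b \<approx> a @ w @ b" if "u \<approx> w" for a b u w
    using that equivp_raag_eq raag_step_imp_raag_eq[OF raag_step_context]
    by (rule raag_eq_preserves)
  from this[of x x' "[]" y] this[of y y' x' "[]"] show ?thesis
    using assms by (auto intro: raag_eq_trans)
qed

lemma raag_eq_append_left: "x \<approx> y \<Longrightarrow> z @ x \<approx> z @ y"
  by (simp add: raag_eq_append)

lemma raag_eq_append_right: "x \<approx> y \<Longrightarrow> x @ z \<approx> y @ z"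
  by (simp add: raag_eq_append)

lemma raag_eq_Cons: "x \<approx> y \<Longrightarrow> l # x \<approx> l # y"
  using raag_eq_append_left[of x y "[l]"] by simp

lemma raag_eq_cancel_letter: "l # inv_letter l # w \<approx> w"
  using raag_step_imp_raag_eq[OF raag_step.cancel[of E "[]" "fst l" "snd l" w]]
  by (simp add: inv_letter_def)

lemma raag_eq_inv_right: "w @ inv_word w \<approx> []"
proof (induction w)
  case (Cons l w)
  have "l # (w @ inv_word w) @ [inv_letter l] \<approx> l # [] @ [inv_letter l]"
    using Cons by (intro raag_eq_Cons raag_eq_append_right)
  also have "\<dots> \<approx> []" using raag_eq_cancel_letter[of l "[]"] by simp
  finally show ?case by simp
qed simp

lemma raag_eq_inv_left: "inv_word w @ w \<approx> []"
proof (induction w)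
  case (Cons l w)
  have "inv_word (l # w) @ l # w \<approx> inv_word w @ w"
    using raag_eq_append_left[OF raag_eq_cancel_letter[of "inv_letter l" w]] by simp
  also have "\<dots> \<approx> []" by (rule Cons)
  finally show ?case .
qed simp

lemma raag_eq_append_inv_append: "b @ inv_word b @ x \<approx> x"
  using raag_eq_append_right[OF raag_eq_inv_right[of b], of x] by simp

lemma raag_eq_append_inv_left: "x @ inv_word a @ a \<approx> x"
  using raag_eq_append_left[OF raag_eq_inv_left[of a], of x] by simp

lemma raag_eq_right_cancel:
  assumes "x @ z \<approx> y @ z"
  shows "x \<approx> y"
proof -
  have cancel: "u \<approx> (u @ z) @ inv_word z" for u
    using raag_eq_append_left[OF raag_eq_inv_right[of z], of u] by (simp add: raag_eq_sym)
  have "x \<approx> (x @ z) @ inv_word z" by (rule cancel)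
  also have "\<dots> \<approx> (y @ z) @ inv_word z" using assms by (rule raag_eq_append_right)
  also have "\<dots> \<approx> y" using cancel by (rule raag_eq_sym)
  finally show ?thesis .
qed

lemma raag_eq_left_cancel:
  assumes "z @ x \<approx> z @ y"
  shows "x \<approx> y"
proof -
  have cancel: "u \<approx> inv_word z @ z @ u" for u
    using raag_eq_append_right[OF raag_eq_inv_left[of z], of u] by (simp add: raag_eq_sym)
  have "x \<approx> inv_word z @ z @ x" by (rule cancel)
  also have "\<dots> \<approx> inv_word z @ z @ y" using assms by (rule raag_eq_append_left)
  also have "\<dots> \<approx> y" using cancel by (rule raag_eq_sym)
  finally show ?thesis .
qed

lemma raag_eq_conj_append: "(a @ y @ inv_word a) @ a \<approx> a @ y"
  using raag_eq_append_inv_left[of "a @ y" a] by simp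

lemma raag_eq_conj_iff: "x \<approx> a @ y @ inv_word a \<longleftrightarrow> x @ a \<approx> a @ y"
proof
  assume "x \<approx> a @ y @ inv_word a"
  then have "x @ a \<approx> (a @ y @ inv_word a) @ a" by (rule raag_eq_append_right)
  also have "\<dots> \<approx> a @ y" by (rule raag_eq_conj_append)
  finally show "x @ a \<approx> a @ y" .
next
  assume "x @ a \<approx> a @ y"
  also have "\<dots> \<approx> (a @ y @ inv_word a) @ a" using raag_eq_conj_append by (rule raag_eq_sym)
  finally show "x \<approx> a @ y @ inv_word a" by (rule raag_eq_right_cancel)
qed

lemma raag_eq_conj_cong:
  assumes "a \<approx> a'" and "x \<approx> x'"
  shows "a @ x @ inv_word a \<approx> a' @ x' @ inv_word a'"
proof -
  have "(a @ x @ inv_word a) @ a' \<approx> (a @ x @ inv_word a) @ a"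
    using raag_eq_sym[OF assms(1)] by (rule raag_eq_append_left)
  also have "\<dots> \<approx> a @ x" by (rule raag_eq_conj_append)
  also have "\<dots> \<approx> a' @ x'" using assms by (rule raag_eq_append)
  finally show ?thesis by (simp only: raag_eq_conj_iff)
qed

lemma intertwine_append:
  assumes "x @ a \<approx> a @ y" and "y @ b \<approx> b @ z"
  shows "x @ a @ b \<approx> (a @ b) @ z"
proof -
  have "(x @ a) @ b \<approx> (a @ y) @ b" using assms(1) by (rule raag_eq_append_right)
  also have "\<dots> = a @ y @ b" by simp
  also have "\<dots> \<approx> a @ b @ z" using assms(2) by (rule raag_eq_append_left)
  finally show ?thesis by simp
qed

lemma intertwine_pow_word:
  assumes "x @ a \<approx> a @ y"
  shows "pow_word x n @ a \<approx> a @ pow_word y n"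
proof (induction n)
  case (Suc n)
  have "x @ pow_word x n @ a \<approx> x @ a @ pow_word y n" using Suc by (rule raag_eq_append_left)
  also have "\<dots> = (x @ a) @ pow_word y n" by simp
  also have "\<dots> \<approx> (a @ y) @ pow_word y n" using assms by (rule raag_eq_append_right)
  finally show ?case by simp
qed simp

lemma conj_intertwines_power:
  assumes "h \<approx> a @ pow_word g n @ b"
  shows "(a @ g @ inv_word a) @ h \<approx> h @ inv_word b @ g @ b"
proof -
  let ?x = "a @ g @ inv_word a" and ?y = "inv_word b @ g @ b"
  have "g @ pow_word g n \<approx> pow_word g n @ g"
    using pow_word_Suc_right[of g n] by simp
  moreover have "g @ b \<approx> b @ ?y"
    using raag_eq_append_inv_append by (rule raag_eq_sym)
  ultimately have "g @ pow_word g n @ b \<approx> (pow_word g n @ b) @ ?y"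
    by (rule intertwine_append)
  note intertwine = intertwine_append[OF raag_eq_conj_append this]
  have "?x @ h \<approx> ?x @ a @ pow_word g n @ b"
    using assms by (rule raag_eq_append_left)
  also have "\<dots> \<approx> (a @ pow_word g n @ b) @ ?y" by (rule intertwine)
  also have "\<dots> \<approx> h @ ?y"
    using raag_eq_sym[OF assms] by (rule raag_eq_append_right)
  finally show ?thesis .
qed

lemma conj_right_eq_of_conj_left_eq:
  assumes "h \<approx> a\<^sub>1 @ pow_word g\<^sub>1 n\<^sub>1 @ b\<^sub>1" and "h \<approx> a\<^sub>2 @ pow_word g\<^sub>2 n\<^sub>2 @ b\<^sub>2"
    and "a\<^sub>1 @ g\<^sub>1 @ inv_word a\<^sub>1 \<approx> a\<^sub>2 @ g\<^sub>2 @ inv_word a\<^sub>2"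
  shows "inv_word b\<^sub>1 @ g\<^sub>1 @ b\<^sub>1 \<approx> inv_word b\<^sub>2 @ g\<^sub>2 @ b\<^sub>2"
proof (rule raag_eq_left_cancel)
  have "h @ inv_word b\<^sub>1 @ g\<^sub>1 @ b\<^sub>1 \<approx> (a\<^sub>1 @ g\<^sub>1 @ inv_word a\<^sub>1) @ h"
    using conj_intertwines_power[OF assms(1)] by (rule raag_eq_sym)
  also have "\<dots> \<approx> (a\<^sub>2 @ g\<^sub>2 @ inv_word a\<^sub>2) @ h"
    using assms(3) by (rule raag_eq_append_right)
  also have "\<dots> \<approx> h @ inv_word b\<^sub>2 @ g\<^sub>2 @ b\<^sub>2"
    using assms(2) by (rule conj_intertwines_power)
  finally show "h @ inv_word b\<^sub>1 @ g\<^sub>1 @ b\<^sub>1 \<approx> h @ inv_word b\<^sub>2 @ g\<^sub>2 @ b\<^sub>2" .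
qed

lemma conj_left_eq_of_overlap:
  assumes "a\<^sub>1 @ c \<approx> a\<^sub>2 @ pow_word g\<^sub>2 j" and "g\<^sub>1 @ c \<approx> c @ g\<^sub>2"
  shows "a\<^sub>1 @ g\<^sub>1 @ inv_word a\<^sub>1 \<approx> a\<^sub>2 @ g\<^sub>2 @ inv_word a\<^sub>2"
proof (rule raag_eq_right_cancel)
  let ?x\<^sub>1 = "a\<^sub>1 @ g\<^sub>1 @ inv_word a\<^sub>1" and ?x\<^sub>2 = "a\<^sub>2 @ g\<^sub>2 @ inv_word a\<^sub>2"
  have "?x\<^sub>1 @ a\<^sub>2 @ pow_word g\<^sub>2 j \<approx> ?x\<^sub>1 @ a\<^sub>1 @ c"
    using raag_eq_sym[OF assms(1)] by (rule raag_eq_append_left)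
  also have "\<dots> \<approx> (a\<^sub>1 @ c) @ g\<^sub>2"
    using raag_eq_conj_append assms(2) by (rule intertwine_append)
  also have "\<dots> \<approx> (a\<^sub>2 @ pow_word g\<^sub>2 j) @ g\<^sub>2"
    using assms(1) by (rule raag_eq_append_right)
  also have "\<dots> = (a\<^sub>2 @ g\<^sub>2) @ pow_word g\<^sub>2 j"
    using pow_word_Suc_right[of g\<^sub>2 j] by simp
  also have "\<dots> \<approx> (?x\<^sub>2 @ a\<^sub>2) @ pow_word g\<^sub>2 j"
    using raag_eq_sym[OF raag_eq_conj_append] by (rule raag_eq_append_right)
  finally show "?x\<^sub>1 @ a\<^sub>2 @ pow_word g\<^sub>2 j \<approx> ?x\<^sub>2 @ a\<^sub>2 @ pow_word g\<^sub>2 j" by simp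
qed

lemma primitive_iff:
  "primitive V E g \<longleftrightarrow> (\<forall>u n. is_word V u \<longrightarrow> g \<approx> pow_word u n \<longrightarrow> n = 1)"
proof
  assume g: "primitive V E g"
  show "\<forall>u n. is_word V u \<longrightarrow> g \<approx> pow_word u n \<longrightarrow> n = 1"
  proof (intro allI impI)
    fix u n assume u: "is_word V u" "g \<approx> pow_word u n"
    have "n \<noteq> 0" using u(2) g by (metis primitive_def pow_word_simps(1))
    moreover have "\<not> n \<ge> 2" using u g unfolding primitive_def by blast
    ultimately show "n = 1" by linarith
  qed
next
  assume unique: "\<forall>u n. is_word V u \<longrightarrow> g \<approx> pow_word u n \<longrightarrow> n = 1"
  have "\<not> g \<approx> []"
  proof
    assume "g \<approx> []"
    then have "g \<approx> pow_word [] 0" by simp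
    moreover have "is_word V []" by simp
    ultimately show False using unique by (metis zero_neq_one)
  qed
  moreover have "\<not> g \<approx> pow_word u n" if "is_word V u" "n \<ge> 2" for u n
    using unique that by (metis numeral_le_one_iff semiring_norm(69))
  ultimately show "primitive V E g" unfolding primitive_def by blast
qed

lemma primitive_conj:
  assumes "primitive V E g" and "g @ c \<approx> c @ g'" and "is_word V c"
  shows "primitive V E g'"
  unfolding primitive_iff
proof (intro allI impI)
  fix u n assume u: "is_word V u" and "g' \<approx> pow_word u n"
  then have "g @ c \<approx> c @ pow_word u n"
    using assms(2) raag_eq_append_left raag_eq_trans by blast
  also have "\<dots> \<approx> pow_word (c @ u @ inv_word c) n @ c"
    using intertwine_pow_word[OF raag_eq_conj_append] by (rule raag_eq_sym)
  finally have "g \<approx> pow_word (c @ u @ inv_word c) n" by (rule raag_eq_right_cancel)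
  moreover have "is_word V (c @ u @ inv_word c)" using u assms(3) by (simp add: image_Un)
  ultimately show "n = 1" using assms(1) unfolding primitive_iff by blast
qed

end

section \<open>Traces\<close>

locale dependence_graph =
  fixes E :: "'a \<Rightarrow> 'a \<Rightarrow> bool"
  assumes symp_E: "symp E"
begin

lemma E_sym: "E u v \<Longrightarrow> E v u"
  using symp_E by (rule sympD)

abbreviation dep :: "'a \<Rightarrow> 'a \<Rightarrow> bool" where
  "dep u v \<equiv> u = v \<or> E u v"

abbreviation indep :: "'a \<times> 'b \<Rightarrow> 'a \<times> 'b \<Rightarrow> bool" where
  "indep l m \<equiv> \<not> dep (fst l) (fst m)"

definition trace_eq :: "('a \<times> 'b) list \<Rightarrow> ('a \<times> 'b) list \<Rightarrow> bool" (infix "\<equiv>\<^sub>t" 50) where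
  "x \<equiv>\<^sub>t y \<longleftrightarrow> (\<forall>u v. dep u v \<longrightarrow> proj u v x = proj u v y)"

definition trace_prefix :: "('a \<times> 'b) list \<Rightarrow> ('a \<times> 'b) list \<Rightarrow> bool" (infix "\<preceq>" 50) where
  "x \<preceq> y \<longleftrightarrow> (\<exists>z. y \<equiv>\<^sub>t x @ z)"

lemma indep_sym: "indep l m \<Longrightarrow> indep m l"
  using E_sym by metis

lemma trace_eq_refl [simp]: "x \<equiv>\<^sub>t x"
  by (simp add: trace_eq_def)

lemma trace_eq_trans [trans]: "x \<equiv>\<^sub>t y \<Longrightarrow> y \<equiv>\<^sub>t z \<Longrightarrow> x \<equiv>\<^sub>t z"
  by (simp add: trace_eq_def)

lemma trace_eq_sym: "x \<equiv>\<^sub>t y \<Longrightarrow> y \<equiv>\<^sub>t x"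
  by (simp add: trace_eq_def)

lemma trace_eq_append: "x \<equiv>\<^sub>t x' \<Longrightarrow> y \<equiv>\<^sub>t y' \<Longrightarrow> x @ y \<equiv>\<^sub>t x' @ y'"
  by (simp add: trace_eq_def)

lemma trace_eq_append_cancel [simp]:
  "z @ x \<equiv>\<^sub>t z @ y \<longleftrightarrow> x \<equiv>\<^sub>t y" "x @ z \<equiv>\<^sub>t y @ z \<longleftrightarrow> x \<equiv>\<^sub>t y"
  by (simp_all add: trace_eq_def)

lemma trace_eq_Cons_cancel [simp]: "l # x \<equiv>\<^sub>t l # y \<longleftrightarrow> x \<equiv>\<^sub>t y"
  using trace_eq_append_cancel(1)[of "[l]" x y] by simp

lemma trace_eq_occ:
  assumes "x \<equiv>\<^sub>t y"
  shows "occ x v = occ y v"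
proof -
  have "proj v v x = proj v v y" using assms unfolding trace_eq_def by blast
  then show ?thesis using occ_proj(1)[of v v x] occ_proj(1)[of v v y] by simp
qed

lemma trace_eq_mset:
  assumes "x \<equiv>\<^sub>t y"
  shows "mset x = mset y"
proof (rule multiset_eqI)
  fix l
  have "count (mset w) l = count (mset (proj (fst l) (fst l) w)) l" for w :: "('a \<times> 'b) list"
    by (induction w) auto
  moreover have "proj (fst l) (fst l) x = proj (fst l) (fst l) y"
    using assms unfolding trace_eq_def by blast
  ultimately show "count (mset x) l = count (mset y) l" by metis
qed

lemma trace_eq_length: "x \<equiv>\<^sub>t y \<Longrightarrow> length x = length y"
  and trace_eq_set: "x \<equiv>\<^sub>t y \<Longrightarrow> set x = set y"
  by (auto dest: trace_eq_mset mset_eq_length mset_eq_setD)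

lemma trace_eq_Nil_iff: "x \<equiv>\<^sub>t [] \<longleftrightarrow> x = []"
  by (auto dest: trace_eq_length)

lemma trace_eq_move_front:
  assumes "\<forall>m\<in>set s. indep l m"
  shows "s @ l # t \<equiv>\<^sub>t l # s @ t"
  unfolding trace_eq_def
proof (intro allI impI)
  fix u v assume "dep u v"
  then have "proj u v s = []" if "fst l = u \<or> fst l = v"
    unfolding filter_empty_conv using assms that E_sym by blast
  then show "proj u v (s @ l # t) = proj u v (l # s @ t)" by auto
qed

lemma prefix_proj_Cons_split:
  assumes prefix: "\<And>u v. dep u v \<Longrightarrow> prefix (proj u v (l # p)) (proj u v q)"
  obtains s t where "q = s @ l # t" and "\<forall>m\<in>set s. indep l m"
proof -
  let ?a = "fst l"
  have "prefix (l # proj ?a ?a p) (proj ?a ?a q)" using prefix[of ?a ?a] by simp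
  then have "l \<in> set (proj ?a ?a q)" using set_mono_prefix by fastforce
  then have "\<exists>m\<in>set q. fst m = ?a" by auto
  then obtain s l' t where q: "q = s @ l' # t" "fst l' = ?a" "\<forall>m\<in>set s. fst m \<noteq> ?a"
    using split_list_first_prop[of q "\<lambda>m. fst m = ?a"] by blast
  then have "proj ?a ?a s = []" by (simp add: filter_empty_conv)
  then have "l' = l" using prefix[of ?a ?a] q by (simp add: prefix_def)
  moreover have "indep l m" if m: "m \<in> set s" for m
  proof
    assume dep: "dep ?a (fst m)"
    let ?P = "proj ?a (fst m)"
    have "prefix (l # ?P p) (?P s @ ?P (l' # t))" using prefix[OF dep] q(1) by simp
    moreover have "m \<in> set (?P s)" using m by simp
    ultimately have "l \<in> set (?P s)" by (cases "?P s") auto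
    then show False using q(3) by auto
  qed
  ultimately show ?thesis using that q(1) by blast
qed

lemma trace_eq_Cons_split:
  assumes "l # w \<equiv>\<^sub>t q"
  obtains s t where "q = s @ l # t" and "\<forall>m\<in>set s. indep l m" and "w \<equiv>\<^sub>t s @ t"
proof -
  have "proj u v (l # w) = proj u v q" if "dep u v" for u v
    using assms that unfolding trace_eq_def by blast
  then have "prefix (proj u v (l # w)) (proj u v q)" if "dep u v" for u v
    using that by (simp only: prefix_order.refl)
  then obtain s t where q: "q = s @ l # t" "\<forall>m\<in>set s. indep l m"
    by (rule prefix_proj_Cons_split)
  have "s @ l # t \<equiv>\<^sub>t l # s @ t" using q(2) by (rule trace_eq_move_front)
  with assms have "l # w \<equiv>\<^sub>t l # s @ t" unfolding q(1) by (rule trace_eq_trans)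
  with q that show ?thesis by simp
qed

lemma trace_eq_diamond:
  assumes "l # x \<equiv>\<^sub>t m # y" and "l \<noteq> m"
  obtains z where "indep l m" and "x \<equiv>\<^sub>t m # z" and "y \<equiv>\<^sub>t l # z"
proof -
  obtain s t where split: "m # y = s @ l # t" "\<forall>k\<in>set s. indep l k" "x \<equiv>\<^sub>t s @ t"
    using assms(1) by (rule trace_eq_Cons_split)
  with assms(2) obtain s' where s: "s = m # s'" by (cases s) auto
  then have "y \<equiv>\<^sub>t l # s' @ t" using split trace_eq_move_front[of s' l t] by simp
  with that[of "s' @ t"] split s show ?thesis by simp
qed

lemma trace_prefix_append [simp]: "x \<preceq> x @ y"
  unfolding trace_prefix_def using trace_eq_refl by blast

lemma trace_prefix_trans [trans]:
  assumes "x \<preceq> y" and "y \<preceq> z"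
  shows "x \<preceq> z"
proof -
  obtain c d where "y \<equiv>\<^sub>t x @ c" "z \<equiv>\<^sub>t y @ d"
    using assms by (auto simp: trace_prefix_def)
  then have "z \<equiv>\<^sub>t x @ c @ d" using trace_eq_append[of y "x @ c" d d] by (auto intro: trace_eq_trans)
  then show ?thesis by (auto simp: trace_prefix_def)
qed

lemma trace_eq_imp_prefix: "x \<equiv>\<^sub>t y \<Longrightarrow> x \<preceq> y"
  unfolding trace_prefix_def by (intro exI[of _ "[]"]) (simp add: trace_eq_sym)

lemma trace_prefix_eq_trans [trans]: "x \<preceq> y \<Longrightarrow> y \<equiv>\<^sub>t z \<Longrightarrow> x \<preceq> z"
  using trace_eq_imp_prefix trace_prefix_trans by blast

lemma trace_eq_prefix_trans [trans]: "x \<equiv>\<^sub>t y \<Longrightarrow> y \<preceq> z \<Longrightarrow> x \<preceq> z"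
  using trace_eq_imp_prefix trace_prefix_trans by blast

lemma trace_prefix_append_cancel [simp]: "z @ x \<preceq> z @ y \<longleftrightarrow> x \<preceq> y"
  by (simp add: trace_prefix_def)

lemma trace_prefix_antisym:
  assumes "x \<preceq> y" and "length y \<le> length x"
  shows "x \<equiv>\<^sub>t y"
proof -
  obtain z where z: "y \<equiv>\<^sub>t x @ z" using assms(1) by (auto simp: trace_prefix_def)
  then have "z = []" using trace_eq_length[OF z] assms(2) by simp
  then show ?thesis using trace_eq_sym[OF z] by simp
qed

lemma trace_prefix_proj:
  assumes "p \<preceq> q" and "dep u v"
  shows "prefix (proj u v p) (proj u v q)"
proof -
  obtain e where "q \<equiv>\<^sub>t p @ e" using assms(1) by (auto simp: trace_prefix_def)
  then have "proj u v q = proj u v p @ proj u v e"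
    using assms(2) by (auto simp: trace_eq_def)
  then show ?thesis by simp
qed

lemma trace_prefixI_proj:
  assumes "\<And>u v. dep u v \<Longrightarrow> prefix (proj u v p) (proj u v q)"
  shows "p \<preceq> q"
  using assms
proof (induction p arbitrary: q)
  case Nil
  show ?case using trace_prefix_append[of "[]" q] by simp
next
  case (Cons l p)
  obtain s t where q: "q = s @ l # t" "\<forall>m\<in>set s. indep l m"
    using Cons.prems by (rule prefix_proj_Cons_split)
  have move: "q \<equiv>\<^sub>t l # s @ t" unfolding q(1) using q(2) by (rule trace_eq_move_front)
  have "prefix (proj u v p) (proj u v (s @ t))" if "dep u v" for u v
  proof -
    have "proj u v q = proj u v (l # s @ t)" using move that unfolding trace_eq_def by blast
    then show ?thesis using Cons.prems[OF that] by (simp split: if_splits)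
  qed
  then have "p \<preceq> s @ t" by (rule Cons.IH)
  then have "l # p \<preceq> l # s @ t" using trace_prefix_append_cancel[of "[l]"] by simp
  then show ?case using trace_eq_sym[OF move] by (rule trace_prefix_eq_trans)
qed

lemma trace_prefix_of_occ_le:
  assumes "p \<preceq> h" and "q \<preceq> h" and "\<And>v. occ p v \<le> occ q v"
  shows "p \<preceq> q"
proof (rule trace_prefixI_proj)
  fix u v assume "dep u v"
  then have "prefix (proj u v p) (proj u v h)" "prefix (proj u v q) (proj u v h)"
    using assms(1,2) trace_prefix_proj by blast+
  moreover have "length (proj u v p) \<le> length (proj u v q)"
    using assms(3) by (simp add: length_proj add_mono)
  ultimately show "prefix (proj u v p) (proj u v q)" by (rule prefix_length_prefix)
qed

lemma trace_prefix_imp_length_le: "p \<preceq> q \<Longrightarrow> length p \<le> length q"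
  by (auto simp: trace_prefix_def dest: trace_eq_length)

lemma trace_prefix_verts: "p \<preceq> q \<Longrightarrow> verts p \<subseteq> verts q"
  by (auto simp: trace_prefix_def image_iff dest!: trace_eq_set)

lemma trace_eq_of_occ_eq:
  assumes "p \<preceq> h" and "q \<preceq> h" and "\<And>v. occ p v = occ q v"
  shows "p \<equiv>\<^sub>t q"
proof -
  have "p \<preceq> q" "q \<preceq> p" using assms trace_prefix_of_occ_le by (metis order_refl)+
  then show ?thesis using trace_prefix_imp_length_le trace_prefix_antisym by blast
qed

lemma prefix_occ_le: "prefix x y \<Longrightarrow> occ x v \<le> occ y v"
  by (auto simp: prefix_def)

lemma occ_le_of_dependent:
  assumes "p \<preceq> h" and "q \<preceq> h" and "E u v" and "occ p v < occ q v"
  shows "occ p u \<le> occ q u"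
proof -
  have "prefix (proj u v p) (proj u v h)" "prefix (proj u v q) (proj u v h)"
    using assms(1-3) trace_prefix_proj by blast+
  then consider (shorter) "prefix (proj u v p) (proj u v q)"
    | (longer) "prefix (proj u v q) (proj u v p)"
    using prefix_same_cases by blast
  then show ?thesis
  proof cases
    case shorter
    from prefix_occ_le[OF this, of u] show ?thesis by (simp add: occ_proj)
  next
    case longer
    from prefix_occ_le[OF this, of v] show ?thesis using assms(4) by (simp add: occ_proj)
  qed
qed

end

section \<open>Normal forms\<close>

locale raag_graph = raag E + dependence_graph E
  for E :: "'a \<Rightarrow> 'a \<Rightarrow> bool"
begin

lemma raag_eq_move_front:
  "\<forall>m\<in>set s. indep l m \<Longrightarrow> s @ l # t \<approx> l # s @ t"
proof (induction s)
  case (Cons m s)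
  have "m # s @ l # t \<approx> m # l # s @ t" using Cons by (intro raag_eq_Cons) auto
  also have "\<dots> \<approx> l # m # s @ t"
  proof -
    have "fst m \<noteq> fst l" "\<not> E (fst m) (fst l)" using Cons.prems E_sym by auto
    then show ?thesis
      using raag_step.swap[of "fst m" "fst l" E "[]" "snd m" "snd l" "s @ t"]
      by (auto intro: raag_step_imp_raag_eq)
  qed
  finally show ?case by simp
qed simp

lemma trace_eq_imp_raag_eq: "x \<equiv>\<^sub>t y \<Longrightarrow> x \<approx> y"
proof (induction x arbitrary: y)
  case Nil
  then have "y = []" using trace_eq_Nil_iff trace_eq_sym by blast
  then show ?case by simp
next
  case (Cons l x)
  obtain s t where y: "y = s @ l # t" "\<forall>m\<in>set s. indep l m" "x \<equiv>\<^sub>t s @ t"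
    using Cons.prems by (rule trace_eq_Cons_split)
  have "l # x \<approx> l # s @ t" using Cons.IH[OF y(3)] by (rule raag_eq_Cons)
  also have "\<dots> \<approx> y" unfolding y(1) using raag_eq_move_front[OF y(2)] by (rule raag_eq_sym)
  finally show ?case .
qed

text \<open>
  The group acts on cancellation-free traces by left multiplication of letters, so evaluating a word
  on the empty trace gives a trace depending only on the element.
\<close>

definition starts :: "'a \<times> bool \<Rightarrow> 'a word \<Rightarrow> bool" where
  "starts l w \<longleftrightarrow> [l] \<preceq> w"

primrec cancel_free :: "'a word \<Rightarrow> bool" where
  "cancel_free [] \<longleftrightarrow> True"
| "cancel_free (l # w) \<longleftrightarrow> \<not> starts (inv_letter l) w \<and> cancel_free w"

definition lmult :: "'a \<times> bool \<Rightarrow> 'a word \<Rightarrow> 'a word" where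
  "lmult l w = (if starts (inv_letter l) w then remove1 (inv_letter l) w else l # w)"

definition nf :: "'a word \<Rightarrow> 'a word" where
  "nf w = foldr lmult w []"

lemma nf_simps [simp]: "nf [] = []" "nf (l # w) = lmult l (nf w)"
  by (simp_all add: nf_def)

lemma starts_iff: "starts l w \<longleftrightarrow> (\<exists>z. w \<equiv>\<^sub>t l # z)"
  by (simp add: starts_def trace_prefix_def)

lemma starts_cong: "w \<equiv>\<^sub>t w' \<Longrightarrow> starts l w \<longleftrightarrow> starts l w'"
  unfolding starts_def using trace_prefix_eq_trans trace_eq_sym by blast

lemma not_starts_Nil [simp]: "\<not> starts l []"
  unfolding starts_def by (auto dest: trace_prefix_imp_length_le)

lemma starts_Cons_indep:
  assumes "indep l m"
  shows "starts l (m # w) \<longleftrightarrow> starts l w"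
proof
  assume "starts l (m # w)"
  then obtain z where "m # w \<equiv>\<^sub>t l # z" by (auto simp: starts_iff)
  moreover have "m \<noteq> l" using assms by auto
  ultimately show "starts l w" by (rule trace_eq_diamond) (auto simp: starts_iff)
next
  assume "starts l w"
  then obtain z where "w \<equiv>\<^sub>t l # z" by (auto simp: starts_iff)
  then have "m # w \<equiv>\<^sub>t m # l # z" by simp
  also have "\<dots> \<equiv>\<^sub>t l # m # z" using trace_eq_move_front[of "[m]" l z] assms by simp
  finally show "starts l (m # w)" by (auto simp: starts_iff)
qed

lemma starts_imp_trace_eq_remove1:
  assumes "starts l w"
  shows "w \<equiv>\<^sub>t l # remove1 l w"
proof -
  obtain z where "l # z \<equiv>\<^sub>t w" using assms trace_eq_sym by (auto simp: starts_iff)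
  then obtain s t where w: "w = s @ l # t" "\<forall>m\<in>set s. indep l m"
    by (rule trace_eq_Cons_split)
  then have "l \<notin> set s" by auto
  then have "remove1 l w = s @ t" using w(1) by (simp add: remove1_append)
  then show ?thesis using trace_eq_move_front[OF w(2), of t] w(1) by simp
qed

lemma lmult_starts: "starts (inv_letter l) w \<Longrightarrow> w \<equiv>\<^sub>t inv_letter l # lmult l w"
  using starts_imp_trace_eq_remove1 by (simp add: lmult_def)

lemma lmult_not_starts: "\<not> starts (inv_letter l) w \<Longrightarrow> lmult l w = l # w"
  by (simp add: lmult_def)

lemma lmult_unique:
  assumes "w \<equiv>\<^sub>t inv_letter l # z"
  shows "lmult l w \<equiv>\<^sub>t z"
proof -
  have "starts (inv_letter l) w" using assms by (auto simp: starts_iff)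
  then have "inv_letter l # lmult l w \<equiv>\<^sub>t inv_letter l # z"
    using lmult_starts assms trace_eq_sym trace_eq_trans by blast
  then show ?thesis by simp
qed

lemma lmult_cong:
  assumes "w \<equiv>\<^sub>t w'"
  shows "lmult l w \<equiv>\<^sub>t lmult l w'"
proof (cases "starts (inv_letter l) w'")
  case True
  then have "w \<equiv>\<^sub>t inv_letter l # lmult l w'" using assms lmult_starts trace_eq_trans by blast
  then show ?thesis by (rule lmult_unique)
next
  case False
  then show ?thesis using assms starts_cong[OF assms] by (simp add: lmult_not_starts)
qed

lemma cancel_free_move_front:
  assumes "\<forall>m\<in>set s. indep l m"
  shows "cancel_free (s @ l # t) \<longleftrightarrow> cancel_free (l # s @ t)"
  using assms
proof (induction s)
  case (Cons m s)
  have "starts (inv_letter m) (s @ l # t) \<longleftrightarrow> starts (inv_letter m) (l # s @ t)"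
    using Cons.prems by (intro starts_cong trace_eq_move_front) simp
  also have "\<dots> \<longleftrightarrow> starts (inv_letter m) (s @ t)"
    using Cons.prems E_sym by (intro starts_Cons_indep) auto
  finally have "starts (inv_letter m) (s @ l # t) \<longleftrightarrow> starts (inv_letter m) (s @ t)" .
  moreover have "starts (inv_letter l) (m # s @ t) \<longleftrightarrow> starts (inv_letter l) (s @ t)"
    using Cons.prems by (intro starts_Cons_indep) simp
  ultimately show ?case using Cons by auto
qed simp

lemma cancel_free_cong: "x \<equiv>\<^sub>t y \<Longrightarrow> cancel_free x \<longleftrightarrow> cancel_free y"
proof (induction x arbitrary: y)
  case Nil
  then have "y = []" using trace_eq_Nil_iff trace_eq_sym by blast
  then show ?case by simp
next
  case (Cons l x)
  obtain s t where y: "y = s @ l # t" "\<forall>m\<in>set s. indep l m" "x \<equiv>\<^sub>t s @ t"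
    using Cons.prems by (rule trace_eq_Cons_split)
  then show ?case
    using Cons.IH[OF y(3)] starts_cong[OF y(3)] cancel_free_move_front[OF y(2)] by simp
qed

lemma cancel_free_lmult:
  assumes "cancel_free w"
  shows "cancel_free (lmult l w)"
proof (cases "starts (inv_letter l) w")
  case True
  then show ?thesis using cancel_free_cong[OF lmult_starts[OF True]] assms by simp
next
  case False
  then show ?thesis using assms by (simp add: lmult_not_starts)
qed

lemma cancel_free_nf: "cancel_free (nf w)"
  by (induction w) (auto simp: cancel_free_lmult)

lemma lmult_inv_letter:
  assumes "cancel_free w"
  shows "lmult l (lmult (inv_letter l) w) \<equiv>\<^sub>t w"
proof (cases "starts l w")
  case True
  let ?z = "lmult (inv_letter l) w"
  have w: "w \<equiv>\<^sub>t l # ?z" using lmult_starts[of "inv_letter l" w] True by simp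
  then have "\<not> starts (inv_letter l) ?z" using cancel_free_cong[OF w] assms by simp
  then show ?thesis using w trace_eq_sym by (simp add: lmult_not_starts)
next
  case False
  then have "lmult (inv_letter l) w = inv_letter l # w" by (simp add: lmult_not_starts)
  then show ?thesis by (simp add: lmult_unique)
qed

lemma starts_lmult_indep:
  assumes "indep k l"
  shows "starts k (lmult l w) \<longleftrightarrow> starts k w"
proof (cases "starts (inv_letter l) w")
  case True
  have "starts k w \<longleftrightarrow> starts k (inv_letter l # lmult l w)"
    using lmult_starts[OF True] by (rule starts_cong)
  also have "\<dots> \<longleftrightarrow> starts k (lmult l w)" using assms by (intro starts_Cons_indep) simp
  finally show ?thesis by simp
next
  case False
  then show ?thesis using assms by (simp add: lmult_not_starts starts_Cons_indep)
qed

lemma lmult_Cons_indep: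
  assumes "indep l m"
  shows "lmult l (m # w) \<equiv>\<^sub>t m # lmult l w"
proof (cases "starts (inv_letter l) w")
  case True
  have "m # w \<equiv>\<^sub>t m # inv_letter l # lmult l w" using lmult_starts[OF True] by simp
  also have "\<dots> \<equiv>\<^sub>t inv_letter l # m # lmult l w"
    using trace_eq_move_front[of "[m]" "inv_letter l" "lmult l w"] assms by simp
  finally show ?thesis by (rule lmult_unique)
next
  case False
  then have "\<not> starts (inv_letter l) (m # w)" using assms starts_Cons_indep by simp
  then show ?thesis
    using False trace_eq_move_front[of "[m]" l w] assms trace_eq_sym by (simp add: lmult_not_starts)
qed

lemma lmult_commute:
  assumes "indep l m"
  shows "lmult l (lmult m w) \<equiv>\<^sub>t lmult m (lmult l w)"
proof (cases "starts (inv_letter m) w")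
  case True
  have "w \<equiv>\<^sub>t inv_letter m # lmult m w" using True by (rule lmult_starts)
  then have "lmult l w \<equiv>\<^sub>t lmult l (inv_letter m # lmult m w)" by (rule lmult_cong)
  also have "\<dots> \<equiv>\<^sub>t inv_letter m # lmult l (lmult m w)"
    using assms by (intro lmult_Cons_indep) simp
  finally show ?thesis using trace_eq_sym[OF lmult_unique] by blast
next
  case False
  moreover have "indep (inv_letter m) l" using indep_sym[OF assms] by simp
  ultimately have "\<not> starts (inv_letter m) (lmult l w)"
    using starts_lmult_indep by blast
  then show ?thesis using False lmult_Cons_indep[OF assms, of w] by (simp add: lmult_not_starts)
qed

lemma nf_append_cong: "nf x \<equiv>\<^sub>t nf y \<Longrightarrow> nf (w @ x) \<equiv>\<^sub>t nf (w @ y)"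
  by (induction w) (auto intro: lmult_cong)

lemma raag_step_imp_trace_eq_nf: "raag_step E x y \<Longrightarrow> nf x \<equiv>\<^sub>t nf y"
proof (induction rule: raag_step.induct)
  case (cancel xs v b ys)
  have "nf ([(v, b), (v, \<not> b)] @ ys) \<equiv>\<^sub>t nf ys"
    using lmult_inv_letter[OF cancel_free_nf, of "(v, b)" ys] by (simp add: inv_letter_def)
  then show ?case by (rule nf_append_cong)
next
  case (swap u v xs b c ys)
  have "nf ([(u, b), (v, c)] @ ys) \<equiv>\<^sub>t nf ([(v, c), (u, b)] @ ys)"
    using lmult_commute[of "(u, b)" "(v, c)"] swap by simp
  then show ?case by (rule nf_append_cong)
qed

lemma raag_eq_imp_trace_eq_nf:
  assumes "x \<approx> y"
  shows "nf x \<equiv>\<^sub>t nf y"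
proof -
  have "equivp trace_eq"
    by (intro equivpI reflpI sympI transpI) (auto intro: trace_eq_sym trace_eq_trans)
  with assms show ?thesis using raag_step_imp_trace_eq_nf by (rule raag_eq_preserves)
qed

lemma raag_eq_lmult: "lmult l w \<approx> l # w"
proof (cases "starts (inv_letter l) w")
  case True
  have "l # w \<approx> l # inv_letter l # lmult l w"
    using lmult_starts[OF True] by (intro raag_eq_Cons trace_eq_imp_raag_eq)
  also have "\<dots> \<approx> lmult l w" by (rule raag_eq_cancel_letter)
  finally show ?thesis by (rule raag_eq_sym)
qed (simp add: lmult_not_starts)

lemma raag_eq_nf: "nf w \<approx> w"
proof (induction w)
  case (Cons l w)
  have "nf (l # w) \<approx> l # nf w" by (simp add: raag_eq_lmult)
  also have "\<dots> \<approx> l # w" using Cons by (rule raag_eq_Cons)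
  finally show ?case .
qed simp

lemma set_lmult: "set (lmult l w) \<subseteq> insert l (set w)"
  using set_remove1_subset[of "inv_letter l" w] by (auto simp: lmult_def)

lemma set_nf: "set (nf w) \<subseteq> set w"
  using set_lmult by (induction w) fastforce+

lemma is_word_nf: "is_word V w \<Longrightarrow> is_word V (nf w)"
  using set_nf by fastforce

lemma length_lmult: "length (lmult l w) \<le> Suc (length w)"
  by (auto simp: lmult_def length_remove1)

lemma length_nf: "length (nf w) \<le> length w"
proof (induction w)
  case (Cons l w)
  then show ?case using length_lmult[of l "nf w"] by simp
qed simp

lemma nf_eq_of_length_eq: "length (nf w) = length w \<Longrightarrow> nf w = w"
proof (induction w)
  case (Cons l w)
  then have len: "length (lmult l (nf w)) = Suc (length w)" by simp
  then have "nf w = w" using Cons.IH length_lmult[of l "nf w"] length_nf[of w] by simp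
  moreover have "\<not> starts (inv_letter l) (nf w)"
    using len length_nf[of w] by (auto simp: lmult_def length_remove1 split: if_splits)
  ultimately show ?case by (simp add: lmult_not_starts)
qed simp

lemma wlen_eq_length_nf:
  assumes "is_word V w"
  shows "wlen V E w = length (nf w)"
  unfolding wlen_def
proof (rule Least_equality)
  show "\<exists>w'. is_word V w' \<and> w \<approx> w' \<and> length w' = length (nf w)"
    using is_word_nf[OF assms] raag_eq_sym[OF raag_eq_nf] by blast
next
  fix n assume "\<exists>w'. is_word V w' \<and> w \<approx> w' \<and> length w' = n"
  then obtain w' where "w \<approx> w'" "length w' = n" by blast
  then show "length (nf w) \<le> n"
    using trace_eq_length[OF raag_eq_imp_trace_eq_nf[of w w']] length_nf[of w'] by simp
qed

lemma nf_trace_eq_of_geodesic: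
  assumes "h \<approx> w" and "length w = length (nf h)"
  shows "nf h \<equiv>\<^sub>t w"
proof -
  have "length (nf w) = length w"
    using trace_eq_length[OF raag_eq_imp_trace_eq_nf[OF assms(1)]] assms(2) by simp
  then show ?thesis using raag_eq_imp_trace_eq_nf[OF assms(1)] by (simp add: nf_eq_of_length_eq)
qed

lemma supp_eq_verts_nf:
  assumes "is_word V g"
  shows "supp V E g = verts (nf g)"
proof
  show "supp V E g \<subseteq> verts (nf g)"
  proof
    fix v assume "v \<in> supp V E g"
    then obtain w where w: "g \<approx> w" "reduced V E w" "v \<in> verts w" by (auto simp: supp_def)
    have "length w = length (nf w)" using w(2) wlen_eq_length_nf by (auto simp: reduced_def)
    also have "\<dots> = length (nf g)" using trace_eq_length[OF raag_eq_imp_trace_eq_nf[OF w(1)]] by simp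
    finally have "nf g \<equiv>\<^sub>t w" using w(1) by (intro nf_trace_eq_of_geodesic)
    then show "v \<in> verts (nf g)" using w(3) by (simp add: trace_eq_set)
  qed
next
  have "length (nf g) = length (nf (nf g))"
    using trace_eq_length[OF raag_eq_imp_trace_eq_nf[OF raag_eq_nf]] by simp
  then have "reduced V E (nf g)"
    using assms is_word_nf wlen_eq_length_nf by (simp only: reduced_def)
  then show "verts (nf g) \<subseteq> supp V E g"
    unfolding supp_def using raag_eq_sym[OF raag_eq_nf] by blast
qed

end

section \<open>Commuting traces\<close>

definition proportional :: "('a \<Rightarrow> nat) \<Rightarrow> ('a \<Rightarrow> nat) \<Rightarrow> bool" where
  "proportional f g \<longleftrightarrow> (\<forall>u v. f u * g v = g u * f v)"

lemma proportional_sym: "proportional f g \<Longrightarrow> proportional g f"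
  by (simp add: proportional_def)

lemma proportional_comparable:
  assumes "proportional f g"
  shows "f \<le> g \<or> g \<le> f"
proof (rule ccontr)
  assume "\<not> ?thesis"
  then obtain u v where "g u < f u" "f v < g v" by (auto simp: le_fun_def not_le)
  then have "g u * f v < f u * g v" by (intro mult_strict_mono) auto
  then show False using assms by (simp add: proportional_def)
qed

lemma cross_mult_trans:
  fixes a b c a' b' c' :: nat
  assumes "a * b' = a' * b" and "b * c' = b' * c" and "b \<noteq> 0 \<or> b' \<noteq> 0"
  shows "a * c' = a' * c"
proof -
  have "b * (a * c') = a * (b * c')" by (simp only: mult.left_commute)
  also have "\<dots> = (a * b') * c" by (simp only: assms(2) mult.assoc)
  also have "\<dots> = b * (a' * c)" by (simp only: assms(1) mult_ac)
  finally have "b * (a * c') = b * (a' * c)" .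
  moreover have "b' * (a * c') = b' * (a' * c)"
  proof -
    have "b' * (a * c') = (a * b') * c'" by (simp only: mult_ac)
    also have "\<dots> = a' * (b * c')" by (simp only: assms(1) mult.assoc)
    also have "\<dots> = b' * (a' * c)" by (simp only: assms(2) mult_ac)
    finally show ?thesis .
  qed
  ultimately show ?thesis using assms(3) by auto
qed

lemma connected_on_proportional:
  assumes "connected_on E S" and supp: "\<And>v. v \<in> S \<longleftrightarrow> f v \<noteq> 0 \<or> g v \<noteq> 0"
    and edge: "\<And>u v. E u v \<Longrightarrow> f u * g v = g u * f v"
  shows "proportional f g"
  unfolding proportional_def
proof (intro allI)
  fix u v
  show "f u * g v = g u * f v"
  proof (cases "u \<in> S \<and> v \<in> S")
    case True
    then have "(\<lambda>a b. E a b \<and> a \<in> S \<and> b \<in> S)\<^sup>*\<^sup>* u v"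
      using assms(1) unfolding connected_on_def by blast
    then show ?thesis
    proof (induction rule: rtranclp_induct)
      case (step v w)
      then have "f v * g w = g v * f w" "f v \<noteq> 0 \<or> g v \<noteq> 0" using edge supp by auto
      with step.IH show ?case by (rule cross_mult_trans)
    qed simp
  qed (use supp in auto)
qed

context dependence_graph
begin

lemma commuting_occ_dependent:
  assumes "x @ y \<equiv>\<^sub>t y @ x" and "dep u v"
  shows "occ x u * occ y v = occ y u * occ x v"
proof -
  have "proj u v x @ proj u v y = proj u v y @ proj u v x"
    using assms by (auto simp: trace_eq_def)
  then obtain m n z where z: "concat (replicate m z) = proj u v x"
    "concat (replicate n z) = proj u v y"
    using comm_append_are_replicate by blast
  have "occ (concat (replicate k z)) w = k * occ z w" for k w
    by (induction k) auto
  then have "occ (proj u v x) w = m * occ z w" "occ (proj u v y) w = n * occ z w" for w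
    unfolding z[symmetric] by blast+
  then have "occ x w = m * occ z w" "occ y w = n * occ z w" if "w \<in> {u, v}" for w
    using that occ_proj[of u v x] occ_proj[of u v y] by auto
  then show ?thesis by simp
qed

lemma commuting_proportional:
  assumes "x @ y \<equiv>\<^sub>t y @ x" and "connected_on E (verts x \<union> verts y)"
  shows "proportional (occ x) (occ y)"
proof (rule connected_on_proportional)
  show "v \<in> verts x \<union> verts y \<longleftrightarrow> occ x v \<noteq> 0 \<or> occ y v \<noteq> 0" for v
    using occ_pos_iff[of x v] occ_pos_iff[of y v] by simp
  show "occ x u * occ y v = occ y u * occ x v" if "E u v" for u v
    using commuting_occ_dependent[OF assms(1)] that by blast
qed (rule assms(2))

lemma commuting_occ_le_extend:
  assumes "x @ y \<equiv>\<^sub>t y @ x" and "occ x \<le> occ y"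
  obtains e where "y \<equiv>\<^sub>t x @ e" and "x @ e \<equiv>\<^sub>t e @ x"
proof -
  have "x \<preceq> y @ x" using assms(1) trace_prefix_append trace_prefix_eq_trans by blast
  then have "x \<preceq> y" using trace_prefix_append
    by (rule trace_prefix_of_occ_le) (rule le_funD[OF assms(2)])
  then obtain e where e: "y \<equiv>\<^sub>t x @ e" by (auto simp: trace_prefix_def)
  have "x @ x @ e \<equiv>\<^sub>t x @ y" using e trace_eq_sym by simp
  also have "\<dots> \<equiv>\<^sub>t y @ x" by (rule assms(1))
  also have "\<dots> \<equiv>\<^sub>t (x @ e) @ x" using e by (simp only: trace_eq_append_cancel)
  finally have "x @ e \<equiv>\<^sub>t e @ x" by simp
  with e that show ?thesis by blast
qed

definition common_root :: "'a word \<Rightarrow> 'a word \<Rightarrow> bool" where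
  "common_root x y \<longleftrightarrow> (\<exists>t p q. x \<equiv>\<^sub>t pow_word t p \<and> y \<equiv>\<^sub>t pow_word t q)"

lemma common_root_sym: "common_root x y \<Longrightarrow> common_root y x"
  by (auto simp: common_root_def)

lemma common_root_Nil: "common_root [] y"
proof -
  have "[] \<equiv>\<^sub>t pow_word y 0" "y \<equiv>\<^sub>t pow_word y 1" by simp_all
  then show ?thesis unfolding common_root_def by blast
qed

lemma common_root_extend:
  assumes "common_root x e" and "y \<equiv>\<^sub>t x @ e"
  shows "common_root x y"
proof -
  obtain t p q where t: "x \<equiv>\<^sub>t pow_word t p" "e \<equiv>\<^sub>t pow_word t q"
    using assms(1) by (auto simp: common_root_def)
  have "x @ e \<equiv>\<^sub>t pow_word t (p + q)"
    unfolding pow_word_add using t by (rule trace_eq_append)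
  with assms(2) have "y \<equiv>\<^sub>t pow_word t (p + q)" by (rule trace_eq_trans)
  with t(1) show ?thesis unfolding common_root_def by blast
qed

text \<open>Proportional occurrence vectors are comparable, so the Euclidean algorithm applies.\<close>

lemma commuting_common_root:
  assumes "x @ y \<equiv>\<^sub>t y @ x" and "proportional (occ x) (occ y)"
  shows "common_root x y"
  using assms
proof (induction "length x + length y" arbitrary: x y rule: less_induct)
  case less
  have subtract: "common_root u w"
    if comm: "u @ w \<equiv>\<^sub>t w @ u" and ratio: "proportional (occ u) (occ w)" and le: "occ u \<le> occ w"
      and len: "length u + length w = length x + length y" for u w
  proof (cases "u = []")
    case False
    obtain e where e: "w \<equiv>\<^sub>t u @ e" "u @ e \<equiv>\<^sub>t e @ u"
      using comm le by (rule commuting_occ_le_extend)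
    have "length u + length e < length x + length y"
      using trace_eq_length[OF e(1)] len False by (simp flip: length_greater_0_conv)
    moreover have "proportional (occ u) (occ e)"
      using ratio trace_eq_occ[OF e(1)] by (auto simp: proportional_def algebra_simps)
    ultimately have "common_root u e" using e(2) less.hyps by blast
    then show ?thesis using e(1) by (rule common_root_extend)
  qed (simp add: common_root_Nil)
  show ?case using proportional_comparable[OF less.prems(2)]
  proof
    assume "occ x \<le> occ y"
    then show ?thesis using less.prems subtract by blast
  next
    assume "occ y \<le> occ x"
    then have "common_root y x"
      using less.prems trace_eq_sym proportional_sym add.commute by (intro subtract) auto
    then show ?thesis by (rule common_root_sym)
  qed
qed

end

context raag_graph
begin

lemma primitive_trace_power:
  assumes "primitive V E x" and "is_word V x" and "x \<equiv>\<^sub>t pow_word t n"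
  shows "n = 1"
proof -
  have x: "x \<approx> pow_word t n" using assms(3) by (rule trace_eq_imp_raag_eq)
  show ?thesis
  proof (cases n)
    case 0
    then show ?thesis using x assms(1) by (simp add: primitive_def)
  next
    case (Suc k)
    then have "set x = set t"
      using trace_eq_set[OF assms(3)] by (simp add: set_pow_word del: pow_word_simps)
    then have "is_word V t" using assms(2) by simp
    then show ?thesis using x assms(1) unfolding primitive_iff by blast
  qed
qed

lemma commuting_primitive_trace_eq:
  assumes "x @ y \<equiv>\<^sub>t y @ x" and "connected_on E (verts x \<union> verts y)"
    and "is_word V x" and "is_word V y" and "primitive V E x" and "primitive V E y"
  shows "x \<equiv>\<^sub>t y"
proof -
  have "common_root x y"
    using assms(1,2) by (intro commuting_common_root commuting_proportional)
  then obtain t p q where t: "x \<equiv>\<^sub>t pow_word t p" "y \<equiv>\<^sub>t pow_word t q"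
    by (auto simp: common_root_def)
  then have "p = 1" "q = 1" using assms(3-6) primitive_trace_power by blast+
  then show ?thesis using t trace_eq_sym trace_eq_trans by fastforce
qed

end

section \<open>Powers inside a trace\<close>

lemma rtranclp_imp_relpowp_less_card:
  assumes "finite A" and "x \<in> A" and closed: "\<And>a b. r a b \<Longrightarrow> b \<in> A" and "r\<^sup>*\<^sup>* x y"
  obtains m where "m < card A" and "(r ^^ m) x y"
proof -
  define m where "m = (LEAST m. (r ^^ m) x y)"
  obtain k where "(r ^^ k) x y" using assms(4) rtranclp_imp_relpowp by metis
  then have m: "(r ^^ m) x y" unfolding m_def by (rule LeastI)
  then obtain f where f: "f 0 = x" "f m = y" "\<forall>i<m. r (f i) (f (Suc i))"
    unfolding relpowp_fun_conv by blast
  have subwalk: "(r ^^ (j - i)) (f i) (f j)" if "i \<le> j" "j \<le> m" for i j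
    unfolding relpowp_fun_conv using f(3) that by (intro exI[of _ "\<lambda>k. f (i + k)"]) simp
  have "f i \<noteq> f j" if "i < j" "j \<le> m" for i j
  proof
    assume "f i = f j"
    then have "(r ^^ i) x (f i)" "(r ^^ (m - j)) (f i) y"
      using subwalk[of 0 i] subwalk[of j m] that f(1,2) by simp_all
    then have "(r ^^ (i + (m - j))) x y" by (rule relpowp_trans)
    moreover have "i + (m - j) < m" using that by simp
    ultimately show False unfolding m_def by (blast dest: not_less_Least)
  qed
  then have "inj_on f {..m}" by (intro linorder_inj_onI) auto
  moreover have "f ` {..m} \<subseteq> A"
  proof (rule image_subsetI)
    fix i assume "i \<in> {..m}"
    then show "f i \<in> A" using f(1,3) assms(2) closed by (cases i) (auto simp: Suc_le_eq)
  qed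
  ultimately have "card {..m} \<le> card A" using assms(1) by (metis card_inj_on_le)
  then show ?thesis using that[of m] m by simp
qed

lemma ex_multiple_between:
  fixes k l :: nat
  assumes "0 < l"
  obtains t where "k \<le> t * l" and "t * l \<le> k + l"
proof
  show "k \<le> Suc (k div l) * l"
    using dividend_less_times_div[OF assms, of k] by (simp add: mult.commute)
  show "Suc (k div l) * l \<le> k + l"
    using div_times_less_eq_dividend[of k l] by simp
qed

locale finite_raag_graph = raag_graph E for E :: "'a \<Rightarrow> 'a \<Rightarrow> bool" +
  fixes V :: "'a set"
  assumes finite_V: "finite V"
begin

definition connected_dominating :: "'a set \<Rightarrow> bool" where
  "connected_dominating S \<longleftrightarrow>
     S \<subseteq> V \<and> connected_on E S \<and> (\<forall>v\<in>V. v \<in> S \<or> (\<exists>u\<in>S. E v u))"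

definition power_decomp :: "'a word \<Rightarrow> 'a word \<Rightarrow> 'a word \<Rightarrow> nat \<Rightarrow> 'a word \<Rightarrow> bool" where
  "power_decomp h a g n b \<longleftrightarrow>
     h \<equiv>\<^sub>t a @ pow_word g n @ b \<and> is_word V h \<and> g \<noteq> [] \<and> connected_dominating (verts g)"

lemma connected_dominating_reaches:
  assumes "connected_dominating S" and "S \<noteq> {}" and "v \<in> V" and "u \<in> S"
  shows "(\<lambda>x y. E x y \<and> y \<in> S)\<^sup>*\<^sup>* v u"
proof -
  let ?R = "\<lambda>x y. E x y \<and> y \<in> S"
  have inside: "?R\<^sup>*\<^sup>* w u" if "w \<in> S" for w
  proof -
    have "(\<lambda>x y. E x y \<and> x \<in> S \<and> y \<in> S)\<^sup>*\<^sup>* w u"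
      using assms(1,4) that by (simp add: connected_dominating_def connected_on_def)
    then show ?thesis by (rule rtranclp_mono[THEN predicate2D, rotated]) blast
  qed
  show ?thesis
  proof (cases "v \<in> S")
    case False
    then obtain w where w: "w \<in> S" "E v w"
      using assms(1,3) by (auto simp: connected_dominating_def)
    then show ?thesis using inside[OF w(1)] by (auto intro: converse_rtranclp_into_rtranclp)
  qed (rule inside)
qed

lemma connected_on_Un_dominating:
  assumes "connected_dominating S" and "T \<subseteq> V"
  shows "connected_on E (S \<union> T)"
  unfolding connected_on_def
proof (intro ballI)
  fix u v assume u: "u \<in> S \<union> T" and v: "v \<in> S \<union> T"
  let ?R = "\<lambda>x y. E x y \<and> x \<in> S \<union> T \<and> y \<in> S \<union> T"
  have attach: "\<exists>s\<in>S. w = s \<or> E w s" if "w \<in> S \<union> T" for w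
    using assms that unfolding connected_dominating_def by blast
  obtain s where s: "s \<in> S" "u = s \<or> E u s" using attach[OF u] by blast
  obtain t where t: "t \<in> S" "v = t \<or> E v t" using attach[OF v] by blast
  have "?R\<^sup>*\<^sup>* u s" using s u by auto
  also have "?R\<^sup>*\<^sup>* s t"
  proof -
    have "(\<lambda>x y. E x y \<and> x \<in> S \<and> y \<in> S)\<^sup>*\<^sup>* s t"
      using assms(1) s(1) t(1) unfolding connected_dominating_def connected_on_def by blast
    then show ?thesis by (rule rtranclp_mono[THEN predicate2D, rotated]) blast
  qed
  also have "?R\<^sup>*\<^sup>* t v" using t v E_sym by auto
  finally show "?R\<^sup>*\<^sup>* u v" .
qed

lemma power_decomp_prefix:
  assumes "power_decomp h a g n b" and "k \<le> n"
  shows "a @ pow_word g k \<preceq> h"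
proof -
  have "h \<equiv>\<^sub>t (a @ pow_word g k) @ pow_word g (n - k) @ b"
    using assms pow_word_add[of g k "n - k"] by (simp add: power_decomp_def)
  then show ?thesis unfolding trace_prefix_def by blast
qed

lemma power_decomp_card_pos:
  assumes "power_decomp h a g n b"
  shows "0 < card V"
proof -
  have "g \<noteq> []" "verts g \<subseteq> V"
    using assms by (auto simp: power_decomp_def connected_dominating_def)
  then show ?thesis using finite_V by (auto simp: card_gt_0_iff)
qed

lemma power_prefix_step:
  assumes h: "power_decomp h a g n b" "q \<preceq> h" and "Suc k \<le> n"
    and "E u v" and "v \<in> verts g" and "occ (a @ pow_word g (Suc k)) u < occ q u"
  shows "occ (a @ pow_word g k) v < occ q v"
proof -
  have "occ (a @ pow_word g (Suc k)) v \<le> occ q v"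
    using power_decomp_prefix[OF h(1) assms(3)] h(2) E_sym[OF assms(4)] assms(6)
    by (rule occ_le_of_dependent)
  moreover have "0 < occ g v" using assms(5) by (simp only: occ_pos_iff)
  ultimately show ?thesis by simp
qed

lemma power_prefix_walk:
  assumes h: "power_decomp h a g n b" "q \<preceq> h"
    and "((\<lambda>x y. E x y \<and> y \<in> verts g) ^^ m) u v" and "k + m \<le> n"
    and "occ (a @ pow_word g (k + m)) u < occ q u"
  shows "occ (a @ pow_word g k) v < occ q v"
  using assms(3-5)
proof (induction m arbitrary: k v)
  case (Suc m)
  from Suc.prems(1) obtain w where w: "((\<lambda>x y. E x y \<and> y \<in> verts g) ^^ m) u w" "E w v" "v \<in> verts g"
    by auto
  have "occ (a @ pow_word g (Suc k)) w < occ q w"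
    using Suc.IH[OF w(1), of "Suc k"] Suc.prems(2,3) by simp
  then show ?case using power_prefix_step[OF h _ w(2,3)] Suc.prems(2) by simp
qed simp

text \<open>
  A prefix that leaves \<open>a g ^ (i + d)\<close> at some vertex has, walking from there through the support of
  \<open>g\<close> and losing one block per edge, swallowed every vertex of \<open>g ^ i\<close>.
\<close>

lemma power_prefix_swallows_support:
  assumes h: "power_decomp h a g n b" "q \<preceq> h" and i: "i + (card V - 1) \<le> n"
    and v: "occ (a @ pow_word g (i + (card V - 1))) v < occ q v" and "u \<in> verts g"
  shows "occ (a @ pow_word g i) u < occ q u"
proof -
  let ?P = "\<lambda>k. a @ pow_word g k" and ?S = "verts g"
  have S: "connected_dominating ?S" "?S \<noteq> {}" and "verts h \<subseteq> V"
    using h(1) by (auto simp: power_decomp_def)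
  have "0 < occ q v" using v by linarith
  then have "v \<in> V"
    using trace_prefix_verts[OF h(2)] \<open>verts h \<subseteq> V\<close> unfolding occ_pos_iff by blast
  obtain m where m: "m < card V" "((\<lambda>x y. E x y \<and> y \<in> ?S) ^^ m) v u"
    using finite_V \<open>v \<in> V\<close> _ connected_dominating_reaches[OF S \<open>v \<in> V\<close> assms(5)]
  proof (rule rtranclp_imp_relpowp_less_card)
    show "y \<in> V" if "E x y \<and> y \<in> ?S" for x y
      using that S(1) by (auto simp: connected_dominating_def)
  qed
  have "occ (?P (i + m)) v \<le> occ (?P (i + (card V - 1))) v" using m(1) by auto
  with v have "occ (?P (i + m)) v < occ q v" by (rule le_less_trans[rotated])
  then show ?thesis using m i by (intro power_prefix_walk[OF h m(2)]) auto
qed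

lemma power_prefix_comparable:
  assumes h: "power_decomp h a g n b" "q \<preceq> h" and i: "i + (card V - 1) \<le> n"
  shows "q \<preceq> a @ pow_word g (i + (card V - 1)) \<or> a @ pow_word g i \<preceq> q"
proof -
  let ?P = "\<lambda>k. a @ pow_word g k" and ?S = "verts g"
  have prefix: "?P (i + (card V - 1)) \<preceq> h" "?P i \<preceq> h"
    using i by (auto intro!: power_decomp_prefix[OF h(1)])
  have S: "connected_dominating ?S" and "verts h \<subseteq> V"
    using h(1) by (auto simp: power_decomp_def)
  then have "verts (?P i) \<subseteq> V" using trace_prefix_verts[OF prefix(2)] by blast
  show ?thesis
  proof (cases "occ q \<le> occ (?P (i + (card V - 1)))")
    case True
    then have "q \<preceq> ?P (i + (card V - 1))"
      by (intro trace_prefix_of_occ_le[OF h(2) prefix(1)]) (simp only: le_fun_def)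
    then show ?thesis ..
  next
    case False
    then obtain v where v: "occ (?P (i + (card V - 1))) v < occ q v"
      unfolding le_fun_def not_all not_le by blast
    note swallowed = power_prefix_swallows_support[OF h i v]
    have "occ (?P i) u \<le> occ q u" for u
    proof -
      consider (support) "u \<in> ?S" | (neighbour) w where "w \<in> ?S" "E u w" | (outside) "u \<notin> V"
        using S unfolding connected_dominating_def by blast
      then show ?thesis
      proof cases
        case support
        then show ?thesis by (rule less_imp_le[OF swallowed])
      next
        case neighbour
        then show ?thesis using occ_le_of_dependent[OF prefix(2) h(2)] swallowed by blast
      next
        case outside
        then show ?thesis using \<open>verts (?P i) \<subseteq> V\<close> occ_pos_iff[of "?P i" u] by auto
      qed
    qed
    then have "?P i \<preceq> q" by (rule trace_prefix_of_occ_le[OF prefix(2) h(2)])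
    then show ?thesis ..
  qed
qed

lemma short_prefix_of_power:
  assumes h: "power_decomp h a g n b" "q \<preceq> h" and i: "i + (card V - 1) \<le> n"
    and "length q \<le> length a + i * length g"
  shows "q \<preceq> a @ pow_word g (i + (card V - 1))"
  using power_prefix_comparable[OF h i]
proof
  assume "a @ pow_word g i \<preceq> q"
  then have "a @ pow_word g i \<equiv>\<^sub>t q" using assms(4) by (intro trace_prefix_antisym) simp_all
  then have "q \<preceq> a @ pow_word g i" using trace_eq_sym trace_eq_imp_prefix by blast
  also have "\<dots> \<preceq> a @ pow_word g (i + (card V - 1))" by (simp add: pow_word_add)
  finally show ?thesis .
qed

lemma prefix_insert_period:
  assumes h: "power_decomp h a g n b" and "a @ r \<preceq> h"
    and "length (a @ r) + card V * length g \<le> length a + n * length g"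
  shows "a @ g @ r \<preceq> h"
proof -
  have "0 < card V" using h by (rule power_decomp_card_pos)
  have "0 < length g" using h by (simp add: power_decomp_def)
  moreover have "card V * length g \<le> n * length g"
    using assms(3) unfolding length_append by linarith
  ultimately have "card V \<le> n" by (metis mult_le_cancel2)
  define i where "i = n - card V"
  have n: "i + (card V - 1) \<le> n" "Suc (i + (card V - 1)) = n"
    using \<open>card V \<le> n\<close> \<open>0 < card V\<close> by (auto simp: i_def)
  have "length (a @ r) \<le> length a + i * length g"
    using assms(3) \<open>card V \<le> n\<close> by (simp add: i_def diff_mult_distrib)
  then have "r \<preceq> pow_word g (i + (card V - 1))"
    using short_prefix_of_power[OF h assms(2) n(1)] by simp
  then have "a @ g @ r \<preceq> a @ pow_word g n" by (simp flip: n(2))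
  also have "\<dots> \<preceq> h" using h by (rule power_decomp_prefix) simp
  finally show ?thesis .
qed

section \<open>Overlapping powers\<close>

lemma ex_aligned_power:
  assumes h: "power_decomp h a g n b" "p \<preceq> h" and M: "length p \<le> M" "length a \<le> M"
    and room: "M + (card V + 1) * length g \<le> length a + n * length g"
  obtains c j where "p @ c \<equiv>\<^sub>t a @ pow_word g j" and "j < n"
    and "length (p @ c) \<le> M + card V * length g"
proof -
  have "0 < card V" using h(1) by (rule power_decomp_card_pos)
  have g: "0 < length g" using h(1) by (simp add: power_decomp_def)
  obtain t where "length p - length a \<le> t * length g"
    "t * length g \<le> length p - length a + length g"
    using g by (rule ex_multiple_between)
  then have t: "length p \<le> length a + t * length g" "length a + t * length g \<le> M + length g"
    using M by linarith+
  define j where "j = t + (card V - 1)"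
  have "t + card V = j + 1" using \<open>0 < card V\<close> by (simp add: j_def)
  then have j: "t * length g + card V * length g = j * length g + length g"
    by (metis add_mult_distrib mult_1)
  have "(card V + 1) * length g = card V * length g + length g" by simp
  then have "(j + 1) * length g \<le> n * length g"
    using t(2) room j unfolding add_mult_distrib by linarith
  then have "j < n" using g by (metis Suc_eq_plus1 Suc_le_eq mult_le_cancel2)
  then have "p \<preceq> a @ pow_word g j"
    using short_prefix_of_power[OF h _ t(1)] by (simp add: j_def)
  then obtain c where c: "a @ pow_word g j \<equiv>\<^sub>t p @ c" by (auto simp: trace_prefix_def)
  have "length (p @ c) = length a + j * length g" using trace_eq_length[OF c] by simp
  then have "length (p @ c) \<le> M + card V * length g" using t(2) j by linarith
  with trace_eq_sym[OF c] \<open>j < n\<close> that show ?thesis by blast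
qed

lemma insert_period_conj:
  assumes h: "power_decomp h a g n b" and "a @ c @ s \<preceq> h"
    and "length (a @ c @ s) + card V * length g \<le> length a + n * length g"
  obtains g' where "g @ c \<equiv>\<^sub>t c @ g'" and "a @ c @ g' @ s \<preceq> h"
proof -
  have insert: "a @ g @ c @ s \<preceq> h" using assms by (rule prefix_insert_period)
  have "a @ c \<preceq> h" "a @ g @ c \<preceq> h"
    using trace_prefix_trans[OF trace_prefix_append, of "a @ c" s h]
      trace_prefix_trans[OF trace_prefix_append, of "a @ g @ c" s h] assms(2) insert by simp_all
  then have "a @ c \<preceq> a @ g @ c" by (rule trace_prefix_of_occ_le) simp
  then obtain g' where g': "g @ c \<equiv>\<^sub>t c @ g'" by (auto simp: trace_prefix_def)
  then have "(c @ g') @ s \<equiv>\<^sub>t (g @ c) @ s" by (simp only: trace_eq_append_cancel trace_eq_sym)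
  then have "a @ c @ g' @ s \<equiv>\<^sub>t a @ g @ c @ s" by simp
  then have "a @ c @ g' @ s \<preceq> h" using insert by (rule trace_eq_prefix_trans)
  with g' that show ?thesis by blast
qed

lemma aligned_powers_commute:
  assumes h\<^sub>1: "power_decomp h a\<^sub>1 g\<^sub>1 n\<^sub>1 b\<^sub>1" and h\<^sub>2: "power_decomp h a\<^sub>2 g\<^sub>2 n\<^sub>2 b\<^sub>2"
    and c: "a\<^sub>1 @ c \<equiv>\<^sub>t a\<^sub>2 @ pow_word g\<^sub>2 j" and "j < n\<^sub>2"
    and room: "length (a\<^sub>1 @ c) + length g\<^sub>2 + card V * length g\<^sub>1 \<le> length a\<^sub>1 + n\<^sub>1 * length g\<^sub>1"
      "length (a\<^sub>1 @ c) + length g\<^sub>1 + card V * length g\<^sub>2 \<le> length a\<^sub>2 + n\<^sub>2 * length g\<^sub>2"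
  obtains g where "g\<^sub>1 @ c \<equiv>\<^sub>t c @ g" and "g @ g\<^sub>2 \<equiv>\<^sub>t g\<^sub>2 @ g"
proof -
  let ?Q = "a\<^sub>2 @ pow_word g\<^sub>2 j"
  have Q: "?Q @ s \<equiv>\<^sub>t a\<^sub>1 @ c @ s" for s
    using trace_eq_append[OF trace_eq_sym[OF c] trace_eq_refl[of s]] by simp
  have "a\<^sub>1 @ c @ g\<^sub>2 \<equiv>\<^sub>t a\<^sub>2 @ pow_word g\<^sub>2 (Suc j)"
    using trace_eq_sym[OF Q[of g\<^sub>2]] by (simp only: pow_word_Suc_right append_assoc)
  also have "\<dots> \<preceq> h" using h\<^sub>2 Suc_leI[OF \<open>j < n\<^sub>2\<close>] by (rule power_decomp_prefix)
  finally have "a\<^sub>1 @ c @ g\<^sub>2 \<preceq> h" .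
  moreover have "length (a\<^sub>1 @ c @ g\<^sub>2) + card V * length g\<^sub>1 \<le> length a\<^sub>1 + n\<^sub>1 * length g\<^sub>1"
    using room(1) by simp
  ultimately obtain g where g: "g\<^sub>1 @ c \<equiv>\<^sub>t c @ g" "a\<^sub>1 @ c @ g @ g\<^sub>2 \<preceq> h"
    by (rule insert_period_conj[OF h\<^sub>1])
  have first: "?Q @ g @ g\<^sub>2 \<preceq> h" using Q g(2) by (rule trace_eq_prefix_trans)
  then have "a\<^sub>2 @ pow_word g\<^sub>2 j @ g \<preceq> h"
    using trace_prefix_trans[OF trace_prefix_append, of "?Q @ g" g\<^sub>2 h] by simp
  moreover have "length (?Q @ g) = length (a\<^sub>1 @ c) + length g\<^sub>1"
    using trace_eq_length[OF c] trace_eq_length[OF g(1)] by simp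
  ultimately have "a\<^sub>2 @ g\<^sub>2 @ pow_word g\<^sub>2 j @ g \<preceq> h"
    using room(2) by (intro prefix_insert_period[OF h\<^sub>2]) simp_all
  moreover have "a\<^sub>2 @ g\<^sub>2 @ pow_word g\<^sub>2 j @ g = ?Q @ g\<^sub>2 @ g"
    using pow_word_Suc_right[of g\<^sub>2 j] by simp
  ultimately have second: "?Q @ g\<^sub>2 @ g \<preceq> h" by (simp only:)
  have "?Q @ g @ g\<^sub>2 \<equiv>\<^sub>t ?Q @ g\<^sub>2 @ g"
    using first second by (rule trace_eq_of_occ_eq) simp
  then have "g @ g\<^sub>2 \<equiv>\<^sub>t g\<^sub>2 @ g" by (simp only: trace_eq_append_cancel)
  with g(1) that show ?thesis by blast
qed

lemma commuting_conj_of_primitive: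
  assumes g: "g\<^sub>1 @ c \<equiv>\<^sub>t c @ g" "g @ g\<^sub>2 \<equiv>\<^sub>t g\<^sub>2 @ g"
    and "connected_dominating (verts g\<^sub>1)" and "is_word V c" and "is_word V g\<^sub>2"
    and "primitive V E g\<^sub>1" and "primitive V E g\<^sub>2"
  shows "g \<equiv>\<^sub>t g\<^sub>2"
proof (rule commuting_primitive_trace_eq[OF g(2)])
  have "mset g = mset g\<^sub>1" using trace_eq_mset[OF g(1)] by simp
  then have verts_g: "verts g = verts g\<^sub>1" by (metis mset_eq_setD)
  show "connected_on E (verts g \<union> verts g\<^sub>2)"
    unfolding verts_g using assms(3,5) by (intro connected_on_Un_dominating) simp_all
  show "is_word V g" using assms(3) by (simp add: verts_g connected_dominating_def)
  show "primitive V E g"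
    using assms(6) trace_eq_imp_raag_eq[OF g(1)] assms(4) by (rule primitive_conj)
qed (use assms in blast)+

lemma overlapping_primitive_powers:
  assumes h\<^sub>1: "power_decomp h a\<^sub>1 g\<^sub>1 n\<^sub>1 b\<^sub>1" and h\<^sub>2: "power_decomp h a\<^sub>2 g\<^sub>2 n\<^sub>2 b\<^sub>2"
    and primitive: "primitive V E g\<^sub>1" "primitive V E g\<^sub>2"
    and M: "length a\<^sub>1 \<le> M" "length a\<^sub>2 \<le> M" and G: "length g\<^sub>1 \<le> G" "length g\<^sub>2 \<le> G"
    and overlap: "M + (2 * card V + 1) * G \<le> length a\<^sub>1 + n\<^sub>1 * length g\<^sub>1"
      "M + (2 * card V + 1) * G \<le> length a\<^sub>2 + n\<^sub>2 * length g\<^sub>2"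
  obtains c j where "a\<^sub>1 @ c \<equiv>\<^sub>t a\<^sub>2 @ pow_word g\<^sub>2 j" and "g\<^sub>1 @ c \<equiv>\<^sub>t c @ g\<^sub>2"
proof -
  have card_G: "card V * length g\<^sub>1 \<le> card V * G" "card V * length g\<^sub>2 \<le> card V * G"
    using G by (simp_all add: mult_le_mono2)
  have "(2 * card V + 1) * G = 2 * (card V * G) + G" by simp
  note room = overlap[unfolded this]
  have "a\<^sub>1 \<preceq> h" using power_decomp_prefix[OF h\<^sub>1, of 0] by simp
  moreover have "M + (card V + 1) * length g\<^sub>2 \<le> length a\<^sub>2 + n\<^sub>2 * length g\<^sub>2"
    using room(2) card_G(2) G(2) unfolding add_mult_distrib by linarith
  ultimately obtain c j where c: "a\<^sub>1 @ c \<equiv>\<^sub>t a\<^sub>2 @ pow_word g\<^sub>2 j" "j < n\<^sub>2"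
    "length (a\<^sub>1 @ c) \<le> M + card V * length g\<^sub>2"
    using ex_aligned_power[OF h\<^sub>2 _ M] by blast
  have "length (a\<^sub>1 @ c) + length g\<^sub>2 + card V * length g\<^sub>1 \<le> length a\<^sub>1 + n\<^sub>1 * length g\<^sub>1"
    "length (a\<^sub>1 @ c) + length g\<^sub>1 + card V * length g\<^sub>2 \<le> length a\<^sub>2 + n\<^sub>2 * length g\<^sub>2"
    using c(3) room card_G G by linarith+
  with h\<^sub>1 h\<^sub>2 c(1,2) obtain g where g: "g\<^sub>1 @ c \<equiv>\<^sub>t c @ g" "g @ g\<^sub>2 \<equiv>\<^sub>t g\<^sub>2 @ g"
    by (rule aligned_powers_commute)
  have "a\<^sub>1 @ c \<preceq> h"
    using c(1) power_decomp_prefix[OF h\<^sub>2 less_imp_le[OF c(2)]] by (rule trace_eq_prefix_trans)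
  then have "is_word V c"
    using trace_prefix_verts[of "a\<^sub>1 @ c" h] h\<^sub>1 by (auto simp: power_decomp_def)
  then have "g \<equiv>\<^sub>t g\<^sub>2"
    using h\<^sub>1 h\<^sub>2 primitive
    by (intro commuting_conj_of_primitive[OF g]) (simp_all add: power_decomp_def connected_dominating_def)
  then have "c @ g \<equiv>\<^sub>t c @ g\<^sub>2" by simp
  with g(1) have "g\<^sub>1 @ c \<equiv>\<^sub>t c @ g\<^sub>2" by (rule trace_eq_trans)
  with c(1) that show ?thesis by blast
qed

section \<open>Quasi-roots\<close>

lemma strongly_non_split_connected_dominating:
  assumes "strongly_non_split V E g" and "is_word V g"
  shows "connected_dominating (verts (nf g))"
  unfolding connected_dominating_def
proof (intro conjI ballI)
  have supp: "supp V E g = verts (nf g)" using assms(2) by (rule supp_eq_verts_nf)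
  show "verts (nf g) \<subseteq> V" using is_word_nf[OF assms(2)] by simp
  show "connected_on E (verts (nf g))"
    using assms(1) by (simp add: strongly_non_split_def non_split_def supp)
  show "v \<in> verts (nf g) \<or> (\<exists>u\<in>verts (nf g). E v u)" if "v \<in> V" for v
  proof -
    have "supp V E [(v, True)] = {v}"
      using that supp_eq_verts_nf[of V "[(v, True)]"] by (simp add: lmult_not_starts)
    moreover have "\<not> disj_commute V E [(v, True)] g"
      using assms(1) that by (simp add: strongly_non_split_def)
    ultimately show ?thesis by (auto simp: disj_commute_def supp)
  qed
qed

lemma quasi_root_decomp_nf:
  assumes "quasi_root_decomp V E lam N h a g n b" and "is_word V h"
  shows "nf h \<equiv>\<^sub>t nf a @ pow_word (nf g) n @ nf b"
proof (rule nf_trace_eq_of_geodesic)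
  have pow: "pow_word g n \<approx> pow_word (nf g) n"
    using intertwine_pow_word[of g "[]" "nf g" n] raag_eq_sym[OF raag_eq_nf] by simp
  have "h \<approx> a @ pow_word g n @ b" using assms(1) by (simp add: quasi_root_decomp_def)
  also have "\<dots> \<approx> nf a @ pow_word (nf g) n @ nf b"
    using pow raag_eq_sym[OF raag_eq_nf] by (intro raag_eq_append)
  finally show "h \<approx> nf a @ pow_word (nf g) n @ nf b" .
  show "length (nf a @ pow_word (nf g) n @ nf b) = length (nf h)"
    using assms wlen_eq_length_nf by (simp add: quasi_root_decomp_def)
qed

lemma quasi_root_decomp_power_decomp:
  assumes "quasi_root_decomp V E lam N h a g n b" and "is_word V h"
    and "strongly_non_split V E g" and "primitive V E g"
  shows "power_decomp (nf h) (nf a) (nf g) n (nf b)"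
  unfolding power_decomp_def
proof (intro conjI)
  show "nf h \<equiv>\<^sub>t nf a @ pow_word (nf g) n @ nf b"
    using assms(1,2) by (rule quasi_root_decomp_nf)
  show "is_word V (nf h)" using assms(2) by (rule is_word_nf)
  show "nf g \<noteq> []"
    using assms(4) raag_eq_sym[OF raag_eq_nf[of g]] by (auto simp: primitive_def)
  show "connected_dominating (verts (nf g))"
    using assms(3,1) unfolding quasi_root_decomp_def
    by (intro strongly_non_split_connected_dominating) blast+
qed

lemma quasi_root_decomp_lengths:
  assumes decomp: "quasi_root_decomp V E lam N h a g n b"
    and N: "(2 * real (card V) + 1) / (1 - 2 * lam) \<le> real N"
  shows "real (length (nf a)) \<le> lam * real (wlen V E h)"
    and "(2 * real (card V) + 1) * real (length (nf g)) \<le> (1 - 2 * lam) * real (wlen V E h)"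
    and "(1 - lam) * real (wlen V E h) \<le> real (length (nf a) + n * length (nf g))"
proof -
  let ?L = "real (wlen V E h)"
  have wlen: "wlen V E a = length (nf a)" "wlen V E g = length (nf g)" "wlen V E b = length (nf b)"
    using decomp by (simp_all add: quasi_root_decomp_def wlen_eq_length_nf)
  have lam: "0 < 1 - 2 * lam" using decomp by (simp add: quasi_root_decomp_def)
  have "N \<le> n"
    and a: "real (length (nf a)) \<le> lam * ?L" and b: "real (length (nf b)) \<le> lam * ?L"
    and L: "wlen V E h = length (nf a) + n * length (nf g) + length (nf b)"
    using decomp unfolding quasi_root_decomp_def wlen by blast+
  show "real (length (nf a)) \<le> lam * ?L" by (rule a)
  show "(1 - lam) * ?L \<le> real (length (nf a) + n * length (nf g))"
    using b by (simp add: L algebra_simps)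
  have "2 * real (card V) + 1 \<le> (1 - 2 * lam) * real N"
    using N lam by (simp add: pos_divide_le_eq mult.commute)
  also have "\<dots> \<le> (1 - 2 * lam) * real n" using lam \<open>N \<le> n\<close> by simp
  finally have "(2 * real (card V) + 1) * real (length (nf g))
      \<le> (1 - 2 * lam) * real n * real (length (nf g))"
    by (intro mult_right_mono) simp_all
  also have "\<dots> = (1 - 2 * lam) * real (n * length (nf g))" by simp
  also have "\<dots> \<le> (1 - 2 * lam) * ?L" using lam by (intro mult_left_mono) (simp_all add: L)
  finally show "(2 * real (card V) + 1) * real (length (nf g)) \<le> (1 - 2 * lam) * ?L" .
qed

lemma quasi_root_decomps_overlap:
  assumes "quasi_root_decomp V E lam N h a\<^sub>1 g\<^sub>1 n\<^sub>1 b\<^sub>1" "quasi_root_decomp V E lam N h a\<^sub>2 g\<^sub>2 n\<^sub>2 b\<^sub>2"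
    and N: "(2 * real (card V) + 1) / (1 - 2 * lam) \<le> real N"
  shows "max (length (nf a\<^sub>1)) (length (nf a\<^sub>2))
      + (2 * card V + 1) * max (length (nf g\<^sub>1)) (length (nf g\<^sub>2))
    \<le> length (nf a\<^sub>1) + n\<^sub>1 * length (nf g\<^sub>1)" (is "?M + ?k * ?G \<le> _")
proof -
  let ?L = "real (wlen V E h)"
  note lengths\<^sub>1 = quasi_root_decomp_lengths[OF assms(1) N]
    and lengths\<^sub>2 = quasi_root_decomp_lengths[OF assms(2) N]
  have "real ?M \<le> lam * ?L" using lengths\<^sub>1(1) lengths\<^sub>2(1) by (simp add: max_def)
  moreover have "real (?k * ?G) \<le> (1 - 2 * lam) * ?L"
    using lengths\<^sub>1(2) lengths\<^sub>2(2) by (simp add: max_def algebra_simps)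
  ultimately have "real (?M + ?k * ?G) \<le> lam * ?L + (1 - 2 * lam) * ?L" by simp
  also have "\<dots> = (1 - lam) * ?L" by (simp add: algebra_simps)
  also have "\<dots> \<le> real (length (nf a\<^sub>1) + n\<^sub>1 * length (nf g\<^sub>1))" by (rule lengths\<^sub>1(3))
  finally show ?thesis by (simp only: of_nat_le_iff)
qed

lemma quasi_roots_left_conj_eq:
  assumes "quasi_root_decomp V E lam N h a\<^sub>1 g\<^sub>1 n\<^sub>1 b\<^sub>1" "quasi_root_decomp V E lam N h a\<^sub>2 g\<^sub>2 n\<^sub>2 b\<^sub>2"
    and "is_word V h" and N: "(2 * real (card V) + 1) / (1 - 2 * lam) \<le> real N"
    and "strongly_non_split V E g\<^sub>1" "strongly_non_split V E g\<^sub>2"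
    and "primitive V E g\<^sub>1" "primitive V E g\<^sub>2"
  shows "a\<^sub>1 @ g\<^sub>1 @ inv_word a\<^sub>1 \<approx> a\<^sub>2 @ g\<^sub>2 @ inv_word a\<^sub>2"
proof -
  have primitive_nf: "primitive V E (nf g)" if "primitive V E g" for g
    using primitive_conj[OF that, of "[]" "nf g"] raag_eq_sym[OF raag_eq_nf[of g]] by simp
  obtain c j where "nf a\<^sub>1 @ c \<equiv>\<^sub>t nf a\<^sub>2 @ pow_word (nf g\<^sub>2) j" "nf g\<^sub>1 @ c \<equiv>\<^sub>t c @ nf g\<^sub>2"
  proof (rule overlapping_primitive_powers)
    show "power_decomp (nf h) (nf a\<^sub>1) (nf g\<^sub>1) n\<^sub>1 (nf b\<^sub>1)"
      using assms(1,3,5,7) by (rule quasi_root_decomp_power_decomp)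
    show "power_decomp (nf h) (nf a\<^sub>2) (nf g\<^sub>2) n\<^sub>2 (nf b\<^sub>2)"
      using assms(2,3,6,8) by (rule quasi_root_decomp_power_decomp)
  qed (use primitive_nf assms(7,8) quasi_root_decomps_overlap[OF assms(1,2) N]
      quasi_root_decomps_overlap[OF assms(2,1) N] in \<open>simp_all add: max.commute\<close>)
  then have "nf a\<^sub>1 @ nf g\<^sub>1 @ inv_word (nf a\<^sub>1) \<approx> nf a\<^sub>2 @ nf g\<^sub>2 @ inv_word (nf a\<^sub>2)"
    by (intro conj_left_eq_of_overlap trace_eq_imp_raag_eq)
  moreover have "a @ g @ inv_word a \<approx> nf a @ nf g @ inv_word (nf a)" for a g
    using raag_eq_sym[OF raag_eq_nf] by (intro raag_eq_conj_cong)
  ultimately show ?thesis using raag_eq_sym raag_eq_trans by blast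
qed

end

theorem theorem1p9:
  fixes V :: "'a set" and E :: "'a \<Rightarrow> 'a \<Rightarrow> bool" and lam :: real and N :: nat
    and h a1 g1 b1 a2 g2 b2 :: "'a word" and n1 n2 :: nat
  assumes "simple_graph V E" and "connected_on E V"
    and "0 \<le> lam" and "lam < 1/2"
    and "real N \<ge> (2 * real (card V) + 1) / (1 - 2 * lam)"
    and "is_word V h"
    and "quasi_root_decomp V E lam N h a1 g1 n1 b1"
    and "quasi_root_decomp V E lam N h a2 g2 n2 b2"
    and "strongly_non_split V E g1" and "primitive V E g1"
    and "strongly_non_split V E g2" and "primitive V E g2"
  shows "raag_eq E (a1 @ g1 @ inv_word a1) (a2 @ g2 @ inv_word a2)
       \<and> raag_eq E (inv_word b1 @ g1 @ b1) (inv_word b2 @ g2 @ b2)"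
proof -
  interpret finite_raag_graph E V
    using assms(1) by unfold_locales (auto simp: simple_graph_def intro: sympI)
  have "a1 @ g1 @ inv_word a1 \<approx> a2 @ g2 @ inv_word a2"
    using assms(7,8,6,5,9,11,10,12) by (rule quasi_roots_left_conj_eq)
  moreover from this have "inv_word b1 @ g1 @ b1 \<approx> inv_word b2 @ g2 @ b2"
    using assms(7,8) by (intro conj_right_eq_of_conj_left_eq) (auto simp: quasi_root_decomp_def)
  ultimately show ?thesis ..
qed

end
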